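(* Let $H\neq0$ be Hermitian positive semidefinite, $\alpha>0$, $T>0$ and $0<\epsilon<1/4$. The constants implied by $O(\cdot)$ below depend only on $\alpha$. (Access to $U_H$.) There is a Poisson-compiled even polynomial $P_d$ of degree at most $d$ approximating $e^{-T\|H\|^{\alpha}|x|^{\alpha}}$ uniformly on $[-1,1]$ to error at most $\epsilon/2$, where: (a) if $\alpha$ is an even positive integer, $d$ can be chosen with $$d=O\!\left(\Big(T\|H\|^{\alpha}+\log\tfrac1\epsilon\Big)^{\frac1\alpha}\log^{1-\frac1\alpha}\tfrac1\epsilon\right);$$ (b) if $\alpha$ is an odd positive integer or is noninteger, $d$ can be chosen with $$d=O\!\left(\|H\|\Big(\tfrac{T}{\epsilon}\Big)^{\frac1\alpha}\right).$$ (Access to $U_S$.) There is a polynomial $Q(s)=P_{2d}(\sqrt{(1+s)/2})$ of degree at most $d$ in $s$, where $P_{2d}$ is the even Poisson-compiled polynomial for the target $e^{-T\|H\|^{\alpha}|y|^{2\alpha}}$, approximating $e^{-T\|H\|^{\alpha}[(1+s)/2]^{\alpha}}$ uniformly on $s\in[-1,1]$ to error at most $\epsilon/2$, where: (c) if $\alpha$ is a positive integer, $d$ can be chosen with $$d=O\!\left(\Big(T\|H\|^{\alpha}+\log\tfrac1\epsilon\Big)^{\frac1{2\alpha}}\log^{1-\frac1{2\alpha}}\tfrac1\epsilon\right);$$ (d) if $\alpha$ is noninteger, it suffices to take $$d=O\!\left(\sqrt{\|H\|}\Big(\tfrac{T}{\epsilon}\Big)^{\frac1{2\alpha}}\right).$$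 When $T\|H\|^{\alpha}\le\epsilon$, the identity transformation (the constant polynomial $1$) already has error at most $\epsilon$, and the nontrivial terms in these bounds may be omitted.
   Context: Convention: every resource count (degree) is understood to be at least one, and additive constants are omitted, so $d=O(X)$ means $d\le C_\alpha\max\{1,X\}$. $U_H$ is a unitary block encoding of $H/\|H\|$ and $U_S$ a unitary block encoding of $2H/\|H\|-I$ (a block encoding of $M$ is a unitary $U$ with $(\langle0^a|\otimes I)U(|0^a\rangle\otimes I)=M$); they enter the claim only through which scalar target is approximated. Poisson-compiled polynomial for a target $g(x)=e^{-\tau|x|^{\beta}}$ ($\tau,\beta>0$): put $f(y)=\int_{\mathbb R}e^{-\tau|\xi|^{\beta}}e^{2\pi i y\xi}\,d\xi$. For some $h>0$ and $N\in\mathbb N$ and even degree bound $D$, with $J_n$ Bessel functions of the first kind and $T_n$ (subscripted) Chebyshev polynomials of the first kind, $$P_D(x)=h f(0)+2h\sum_{k=1}^{N}f(kh)\Big[J_0(2\pi kh)+2\sum_{j=1}^{D/2}(-1)^jJ_{2j}(2\pi kh)\,T_{2j}(x)\Big].$$ In the $U_H$ case $\tau=T\|H\|^\alpha$, $\beta=\alpha$, $D=d$; in the $U_S$ case $\tau=T\|H\|^\alpha$, $\beta=2\alpha$, $D=2d$. The parameters $h,N$ are free to be chosen. *)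

theory Defs
  imports
    "HOL-Analysis.Analysis"
    "HOL-Computational_Algebra.Polynomial"
    "Jordan_Normal_Form.Schur_Decomposition"
begin

text \<open>
  Matrices are those of \<open>Jordan_Normal_Form\<close>, whose dimension is a term rather than a type, so
  that the constants of the main statement can be chosen uniformly in the dimension.
\<close>

definition l2_norm_vec :: "complex vec \<Rightarrow> real" where
  "l2_norm_vec v = sqrt (\<Sum>i<dim_vec v. (cmod (vec_index v i))\<^sup>2)"

definition op_norm :: "complex mat \<Rightarrow> real" where
  "op_norm A = Sup {l2_norm_vec (A *\<^sub>v v) | v. v \<in> carrier_vec (dim_col A) \<and> l2_norm_vec v = 1}"

definition hermitian_mat :: "complex mat \<Rightarrow> bool" where
  "hermitian_mat A \<longleftrightarrow> square_mat A \<and> mat_adjoint A = A"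

text \<open>For Hermitian \<open>A\<close> the quadratic form is real, so only its real part needs a sign.\<close>

definition hermitian_psd :: "complex mat \<Rightarrow> bool" where
  "hermitian_psd A \<longleftrightarrow> hermitian_mat A \<and>
     (\<forall>v \<in> carrier_vec (dim_row A). 0 \<le> Re ((A *\<^sub>v v) \<bullet>c v))"

definition unitary_mat :: "complex mat \<Rightarrow> bool" where
  "unitary_mat U \<longleftrightarrow> square_mat U \<and>
     U * mat_adjoint U = 1\<^sub>m (dim_row U) \<and> mat_adjoint U * U = 1\<^sub>m (dim_row U)"

text \<open>
  The isometry \<open>|0\<^sup>a\<rangle> \<otimes> I\<close>. The basis vector \<open>|b\<rangle> \<otimes> |i\<rangle>\<close> has index \<open>b * n + i\<close>, so its image is
  spanned by the first \<open>n\<close> basis vectors.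
\<close>

definition ancilla_isometry :: "nat \<Rightarrow> nat \<Rightarrow> complex mat" where
  "ancilla_isometry a n = Matrix.mat (2 ^ a * n) n (\<lambda>(i, j). if i = j then 1 else 0)"

definition block_encoding :: "nat \<Rightarrow> complex mat \<Rightarrow> complex mat \<Rightarrow> bool" where
  "block_encoding a U M \<longleftrightarrow>
     square_mat M \<and> U \<in> carrier_mat (2 ^ a * dim_row M) (2 ^ a * dim_row M) \<and> unitary_mat U \<and>
     mat_adjoint (ancilla_isometry a (dim_row M)) * U * ancilla_isometry a (dim_row M) = M"

fun chebyshev_T :: "nat \<Rightarrow> real poly" where
  "chebyshev_T 0 = 1"
| "chebyshev_T (Suc 0) = [:0, 1:]"
| "chebyshev_T (Suc (Suc n)) = [:0, 2:] * chebyshev_T (Suc n) - chebyshev_T n"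

definition bessel_J :: "nat \<Rightarrow> real \<Rightarrow> real" where
  "bessel_J n x = (\<Sum>m. (-1) ^ m / (fact m * fact (m + n)) * (x / 2) ^ (2 * m + n))"

definition target :: "real \<Rightarrow> real \<Rightarrow> real \<Rightarrow> real" where
  "target \<tau> \<beta> x = exp (- (\<tau> * \<bar>x\<bar> powr \<beta>))"

text \<open>
  The integral is real because the target is even (shown below); taking the real part
  only serves to obtain a function, and hence a polynomial, of real type.
\<close>

definition target_ft :: "real \<Rightarrow> real \<Rightarrow> real \<Rightarrow> real" where
  "target_ft \<tau> \<beta> y = Re (LINT \<xi>|lborel. complex_of_real (target \<tau> \<beta> \<xi>) * cis (2 * pi * y * \<xi>))"

lemma of_real_target_ft:
  "complex_of_real (target_ft \<tau> \<beta> y) =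
     (LINT \<xi>|lborel. complex_of_real (target \<tau> \<beta> \<xi>) * cis (2 * pi * y * \<xi>))" (is "_ = ?I")
proof -
  have "cnj ?I = (LINT \<xi>|lborel. cnj (complex_of_real (target \<tau> \<beta> \<xi>) * cis (2 * pi * y * \<xi>)))"
    by (rule Bochner_Integration.integral_cnj [symmetric])
  also have "\<dots> = (LINT \<xi>|lborel. complex_of_real (target \<tau> \<beta> (0 + (-1) * \<xi>)) *
                       cis (2 * pi * y * (0 + (-1) * \<xi>)))"
    by (simp add: target_def cis_cnj)
  also have "\<dots> = ?I"
    by (subst lborel_integral_real_affine
          [where c = "-1" and t = 0 and f = "\<lambda>\<xi>. complex_of_real (target \<tau> \<beta> \<xi>) * cis (2 * pi * y * \<xi>)"])
       simp_all
  finally have "?I \<in> \<real>"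
    by (simp add: Reals_cnj_iff)
  then show ?thesis
    by (simp add: target_ft_def of_real_Re)
qed

definition poisson_poly :: "real \<Rightarrow> real \<Rightarrow> real \<Rightarrow> nat \<Rightarrow> nat \<Rightarrow> real poly" where
  "poisson_poly \<tau> \<beta> h N D =
     [:h * target_ft \<tau> \<beta> 0:] +
     Polynomial.smult (2 * h) (\<Sum>k = 1..N. Polynomial.smult (target_ft \<tau> \<beta> (real k * h))
       ([:bessel_J 0 (2 * pi * real k * h):] +
        Polynomial.smult 2 (\<Sum>j = 1..D div 2.
          Polynomial.smult ((-1) ^ j * bessel_J (2 * j) (2 * pi * real k * h)) (chebyshev_T (2 * j)))))"

definition even_poly :: "real poly \<Rightarrow> bool" where
  "even_poly p \<longleftrightarrow> (\<forall>x. poly p (- x) = poly p x)"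

definition approximates :: "real poly \<Rightarrow> (real \<Rightarrow> real) \<Rightarrow> real \<Rightarrow> bool" where
  "approximates p g \<eta> \<longleftrightarrow> (\<forall>x \<in> {-1..1}. \<bar>poly p x - g x\<bar> \<le> \<eta>)"

definition S_target :: "real \<Rightarrow> real \<Rightarrow> real \<Rightarrow> real" where
  "S_target \<tau> \<alpha> s = exp (- (\<tau> * ((1 + s) / 2) powr \<alpha>))"

definition H_compiled :: "real \<Rightarrow> real \<Rightarrow> real \<Rightarrow> nat \<Rightarrow> bool" where
  "H_compiled \<tau> \<alpha> \<eta> d \<longleftrightarrow> even d \<and>
     (\<exists>h > 0. \<exists>N. let P = poisson_poly \<tau> \<alpha> h N d in
        even_poly P \<and> degree P \<le> d \<and> approximates P (target \<tau> \<alpha>) \<eta>)"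

definition S_compiled :: "real \<Rightarrow> real \<Rightarrow> real \<Rightarrow> nat \<Rightarrow> bool" where
  "S_compiled \<tau> \<alpha> \<eta> d \<longleftrightarrow>
     (\<exists>h > 0. \<exists>N Q. let P = poisson_poly \<tau> (2 * \<alpha>) h N (2 * d) in
        even_poly P \<and> degree P \<le> 2 * d \<and>
        degree Q \<le> d \<and> (\<forall>s \<in> {-1..1}. poly Q s = poly P (sqrt ((1 + s) / 2))) \<and>
        approximates Q (S_target \<tau> \<alpha>) \<eta>)"

text \<open>\<open>d = O(X)\<close> with constant \<open>C\<close>; degrees are at least one and additive constants are omitted.\<close>

definition degree_bound :: "real \<Rightarrow> nat \<Rightarrow> real \<Rightarrow> bool" where
  "degree_bound C d X \<longleftrightarrow> 1 \<le> d \<and> real d \<le> C * max 1 X"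

end

theory Submission
  imports
    Defs
    "HOL-Probability.Characteristic_Functions"
    "HOL-Probability.Sinc_Integral"
    "HOL-Complex_Analysis.Cauchy_Integral_Theorem"
    "HOL-Real_Asymp.Real_Asymp"
begin

text \<open>
  Since \<open>h\<close> and \<open>N\<close> are free, no Poisson summation is needed. Write \<open>g\<close> for the target and \<open>f\<close> for its
  Fourier transform. With \<open>h = Y/N\<close> and \<open>N \<rightarrow> \<infinity>\<close> the trapezoidal sum tends to the truncated inversion integral
  \<open>2 \<integral>_0^Y f(y) cos (2 \<pi> x y) dy\<close>, whose distance to \<open>g\<close> is at most twice the integral of \<open>|f|\<close> over
  \<open>y > Y\<close>. Truncating the Jacobi-Anger expansion at degree \<open>D \<ge> 48 Y\<close> costs at most \<open>2 (24 y / D)^D\<close> at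
  frequency \<open>y \<le> Y\<close>. So the degree is governed by the decay of \<open>f\<close>: rotating the line of integration gives
  \<open>|f(y)| \<le> C \<tau> y^(-1-\<beta>)\<close> for every \<open>\<beta> > 0\<close>, hence \<open>D ~ (\<tau>/\<epsilon>)^(1/\<beta>)\<close>. If \<open>\<beta> = n\<close> is an even integer,
  shifting the line by \<open>s\<close> gives \<open>|f(y)| \<le> K \<tau>^(-1/n) exp (C \<tau> s^n - 2 \<pi> y s)\<close>, and the choice \<open>\<tau> s^n = ln (1/\<epsilon>)\<close>
  yields the logarithmic bound. For \<open>\<tau> \<le> \<epsilon>\<close> take \<open>N = 0\<close>: the polynomial is a constant, and \<open>h\<close> can be tuned to
  make it the midpoint of the range of \<open>g\<close>, which is accurate to \<open>\<epsilon>/2\<close>.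
\<close>

section \<open>Compiled polynomials\<close>

text \<open>The decay estimate C \<tau> y^(-1-\<beta>) is not integrable at y = 0, so small
  frequencies need a second mechanism. For the power law it is the factor y^D in the Jacobi-Anger
  error bound, which cancels the singularity; for even exponents it is the estimate with shift 0,
  which is uniform in y. If B bounds the error of a single frequency, all of them together cost 2 h
  N B = 2 Y B, so refining the grid costs nothing in degree. For \<open>U_S\<close> the substitution
  x = sqrt ((1+s)/2) doubles the exponent, so every positive integer \<alpha> becomes an even
  exponent, and it turns T_2j(x) into T_j(s), which halves the degree. In the logarithmic bound, the
  summand ln (1/\<epsilon>) next to \<tau> does not come from the tail of f: it pays for 2^(-D)
  having to fall below \<epsilon> even when \<tau> is small.\<close>

lemma poly_chebyshev_T_cos: "poly (chebyshev_T n) (cos \<theta>) = cos (real n * \<theta>)"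
proof (induction n rule: chebyshev_T.induct)
  case (3 n)
  have "cos (real (Suc (Suc n)) * \<theta>) + cos (real n * \<theta>) = 2 * cos \<theta> * cos (real (Suc n) * \<theta>)"
    by (simp add: cos_plus_cos algebra_simps add_divide_distrib)
  then show ?case
    using 3 by simp
qed auto

lemma poly_chebyshev_T_minus: "poly (chebyshev_T n) (- x) = (-1) ^ n * poly (chebyshev_T n) x"
  by (induction n rule: chebyshev_T.induct) (simp_all add: algebra_simps)

lemma degree_chebyshev_T: "degree (chebyshev_T n) \<le> n"
proof (induction n rule: chebyshev_T.induct)
  case (3 n)
  have "degree ([:0, 2:] * chebyshev_T (Suc n)) \<le> Suc (Suc n)"
    using degree_mult_le[of "[:0, 2:]" "chebyshev_T (Suc n)"] 3 by simp
  then show ?case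
    using 3 by (auto intro!: degree_diff_le simp del: mult_pCons_left)
qed auto

text \<open>The composition law T_2j = T_j o T_2. At x = sqrt ((1+s)/2) the inner value 2 x^2 - 1 is
  s itself, which is why the square root disappears.\<close>

lemma poly_chebyshev_T_double:
  assumes "x \<in> {-1..1}"
  shows "poly (chebyshev_T (2 * j)) x = poly (chebyshev_T j) (2 * x\<^sup>2 - 1)"
proof -
  have x: "x = cos (arccos x)"
    using assms by simp
  have "2 * x\<^sup>2 - 1 = cos (2 * arccos x)"
    using assms by (simp add: cos_double_cos)
  then show ?thesis
    by (metis poly_chebyshev_T_cos x mult.assoc mult.commute of_nat_mult of_nat_numeral)
qed

lemma even_poly_poisson_poly: "even_poly (poisson_poly \<tau> \<beta> h N D)"
  by (simp add: even_poly_def poisson_poly_def poly_sum poly_chebyshev_T_minus power_mult)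

lemma degree_poisson_poly: "degree (poisson_poly \<tau> \<beta> h N D) \<le> D"
  unfolding poisson_poly_def
  by (intro degree_add_le degree_sum_le order.trans[OF degree_smult_le] order.trans[OF degree_chebyshev_T])
     auto

text \<open>The witness for Q: \<open>poisson_poly\<close> at degree bound \<open>2 * d\<close> with
  each T_2j replaced by T_j.\<close>

definition poisson_poly_half :: "real \<Rightarrow> real \<Rightarrow> real \<Rightarrow> nat \<Rightarrow> nat \<Rightarrow> real poly" where
  "poisson_poly_half \<tau> \<beta> h N d =
     [:h * target_ft \<tau> \<beta> 0:] +
     Polynomial.smult (2 * h) (\<Sum>k = 1..N. Polynomial.smult (target_ft \<tau> \<beta> (real k * h))
       ([:bessel_J 0 (2 * pi * real k * h):] +
        Polynomial.smult 2 (\<Sum>j = 1..d.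
          Polynomial.smult ((-1) ^ j * bessel_J (2 * j) (2 * pi * real k * h)) (chebyshev_T j))))"

lemma degree_poisson_poly_half: "degree (poisson_poly_half \<tau> \<beta> h N d) \<le> d"
  unfolding poisson_poly_half_def
  by (intro degree_add_le degree_sum_le order.trans[OF degree_smult_le] order.trans[OF degree_chebyshev_T])
     auto

lemma poly_poisson_poly_half:
  assumes "s \<in> {-1..1}"
  shows "poly (poisson_poly_half \<tau> \<beta> h N d) s = poly (poisson_poly \<tau> \<beta> h N (2 * d)) (sqrt ((1 + s) / 2))"
proof -
  have x: "sqrt ((1 + s) / 2) \<in> {-1..1}"
    using assms by (auto simp: real_le_lsqrt real_sqrt_ge_zero order.trans[of "-1" "0::real"])
  have "2 * (sqrt ((1 + s) / 2))\<^sup>2 - 1 = s"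
    using assms by (simp add: field_simps)
  then have "poly (chebyshev_T (2 * j)) (sqrt ((1 + s) / 2)) = poly (chebyshev_T j) s" for j
    using poly_chebyshev_T_double[OF x, of j] by simp
  then show ?thesis
    by (simp add: poisson_poly_def poisson_poly_half_def poly_sum)
qed

lemma H_compiledI:
  assumes "even d" "h > 0" "approximates (poisson_poly \<tau> \<alpha> h N d) (target \<tau> \<alpha>) \<eta>"
  shows "H_compiled \<tau> \<alpha> \<eta> d"
  unfolding H_compiled_def Let_def
  by (intro conjI exI[of _ h] exI[of _ N] assms even_poly_poisson_poly degree_poisson_poly)

lemma S_target_eq_target:
  assumes "s \<in> {-1..1}"
  shows "S_target \<tau> \<alpha> s = target \<tau> (2 * \<alpha>) (sqrt ((1 + s) / 2))"
proof -
  have "sqrt ((1 + s) / 2) = ((1 + s) / 2) powr (1/2)"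
    using assms by (subst powr_half_sqrt) auto
  then have "sqrt ((1 + s) / 2) powr (2 * \<alpha>) = ((1 + s) / 2) powr \<alpha>"
    by (simp only: powr_powr) simp
  then show ?thesis
    using assms by (simp add: S_target_def target_def)
qed

lemma S_compiledI:
  assumes "h > 0" "approximates (poisson_poly \<tau> (2 * \<alpha>) h N (2 * d)) (target \<tau> (2 * \<alpha>)) \<eta>"
  shows "S_compiled \<tau> \<alpha> \<eta> d"
  unfolding S_compiled_def Let_def
proof (rule exI[of _ h], rule conjI[OF assms(1)], rule exI[of _ N],
       rule exI[of _ "poisson_poly_half \<tau> (2 * \<alpha>) h N d"], intro conjI)
  show "approximates (poisson_poly_half \<tau> (2 * \<alpha>) h N d) (S_target \<tau> \<alpha>) \<eta>"
    unfolding approximates_def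
  proof
    fix s :: real assume s: "s \<in> {-1..1}"
    have "sqrt ((1 + s) / 2) \<in> {-1..1}"
      using s by (auto simp: real_le_lsqrt real_sqrt_ge_zero order.trans[of "-1" "0::real"])
    then show "\<bar>poly (poisson_poly_half \<tau> (2 * \<alpha>) h N d) s - S_target \<tau> \<alpha> s\<bar> \<le> \<eta>"
      using assms(2) s by (simp only: approximates_def poly_poisson_poly_half S_target_eq_target)
  qed
qed (use assms(1) in \<open>simp_all add: even_poly_poisson_poly degree_poisson_poly degree_poisson_poly_half
  poly_poisson_poly_half\<close>)

section \<open>Positivity of the operator norm\<close>

text \<open>A real \<open>Sup\<close> can be compared with its elements only if the set is bounded.
  Entries of a unit vector have modulus at most 1, so absolute row sums give a crude bound.\<close>

lemma op_norm_bdd_above: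
  "bdd_above {l2_norm_vec (A *\<^sub>v v) | v. v \<in> carrier_vec (dim_col A) \<and> l2_norm_vec v = 1}"
proof (rule bdd_aboveI)
  fix r assume "r \<in> {l2_norm_vec (A *\<^sub>v v) | v. v \<in> carrier_vec (dim_col A) \<and> l2_norm_vec v = 1}"
  then obtain v where v: "v \<in> carrier_vec (dim_col A)" "l2_norm_vec v = 1" "r = l2_norm_vec (A *\<^sub>v v)"
    by blast
  have v1: "cmod (vec_index v j) \<le> 1" if "j < dim_col A" for j
  proof -
    have "(cmod (vec_index v j))\<^sup>2 \<le> (\<Sum>i<dim_vec v. (cmod (vec_index v i))\<^sup>2)"
      using v that by (intro member_le_sum) auto
    also have "\<dots> = 1"
      using v by (simp add: l2_norm_vec_def)
    finally show ?thesis
      by (rule power2_le_imp_le[of _ 1, simplified])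
  qed
  have "cmod (vec_index (A *\<^sub>v v) i) \<le> (\<Sum>j<dim_col A. cmod (A $$ (i, j)))" if "i < dim_row A" for i
  proof -
    have "vec_index (A *\<^sub>v v) i = (\<Sum>j<dim_col A. A $$ (i, j) * vec_index v j)"
      using that v by (simp add: scalar_prod_def atLeast0LessThan)
    also have "cmod \<dots> \<le> (\<Sum>j<dim_col A. cmod (A $$ (i, j)) * 1)"
      using v1 by (intro sum_norm_le) (auto simp: norm_mult intro!: mult_left_le)
    finally show ?thesis by simp
  qed
  then have "(\<Sum>i<dim_row A. (cmod (vec_index (A *\<^sub>v v) i))\<^sup>2)
      \<le> (\<Sum>i<dim_row A. (\<Sum>j<dim_col A. cmod (A $$ (i, j)))\<^sup>2)"
    by (intro sum_mono power_mono) auto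
  then show "r \<le> sqrt (\<Sum>i<dim_row A. (\<Sum>j<dim_col A. cmod (A $$ (i, j)))\<^sup>2)"
    by (simp add: v l2_norm_vec_def)
qed

lemma op_norm_pos:
  assumes "A \<in> carrier_mat m n" "A \<noteq> 0\<^sub>m m n"
  shows "op_norm A > 0"
proof -
  obtain i j where ij: "i < m" "j < n" "A $$ (i, j) \<noteq> 0"
    using assms by (metis carrier_matD eq_matI index_zero_mat)
  have "(\<Sum>k<n. (cmod (vec_index (unit_vec n j) k))\<^sup>2) = (\<Sum>k<n. if k = j then 1 else 0)"
    using ij by (intro sum.cong) auto
  then have 1: "l2_norm_vec (unit_vec n j) = 1"
    using ij by (simp add: l2_norm_vec_def)
  have "vec_index (A *\<^sub>v unit_vec n j) i = A $$ (i, j)"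
    using ij assms by simp
  then have "0 < (cmod (vec_index (A *\<^sub>v unit_vec n j) i))\<^sup>2"
    using ij by simp
  also have "\<dots> \<le> (\<Sum>k<m. (cmod (vec_index (A *\<^sub>v unit_vec n j) k))\<^sup>2)"
    using ij by (intro member_le_sum) auto
  finally have "0 < l2_norm_vec (A *\<^sub>v unit_vec n j)"
    using assms by (simp add: l2_norm_vec_def)
  also have "\<dots> \<le> op_norm A"
    unfolding op_norm_def
  proof (rule cSup_upper[OF _ op_norm_bdd_above], rule CollectI, rule exI, intro conjI)
    show "unit_vec n j \<in> carrier_vec (dim_col A)"
      using assms by simp
  qed (simp_all add: 1)
  finally show ?thesis .
qed

section \<open>The truncated Jacobi-Anger expansion\<close>

text \<open>Folding about the centre n pairs the frequencies k - n and n - k in the binomial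
  expansion of a power of a cosine.\<close>

lemma sum_atMost_double_fold:
  fixes F :: "nat \<Rightarrow> 'a::comm_monoid_add"
  shows "(\<Sum>k\<le>2 * n. F k) = F n + (\<Sum>j=1..n. F (n - j) + F (n + j))"
proof -
  have "{..2 * n} = {..<n} \<union> insert n {n<..2 * n}"
    by auto
  moreover have "sum F ({..<n} \<union> insert n {n<..2 * n}) = sum F {..<n} + sum F (insert n {n<..2 * n})"
    by (rule sum.union_disjoint) auto
  ultimately have "(\<Sum>k\<le>2 * n. F k) = (\<Sum>k<n. F k) + (F n + (\<Sum>k\<in>{n<..2 * n}. F k))"
    by simp
  moreover have "(\<Sum>k<n. F k) = (\<Sum>j=1..n. F (n - j))"
    by (rule sum.reindex_bij_witness[of _ "\<lambda>j. n - j" "\<lambda>k. n - k"]) auto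
  moreover have "(\<Sum>k\<in>{n<..2 * n}. F k) = (\<Sum>j=1..n. F (n + j))"
    by (rule sum.reindex_bij_witness[of _ "\<lambda>j. n + j" "\<lambda>k. k - n"]) auto
  ultimately show ?thesis
    by (simp add: sum.distrib ac_simps)
qed

lemma binomial_central_symmetric: "j \<le> n \<Longrightarrow> (2 * n) choose (n + j) = (2 * n) choose (n - j)"
  using binomial_symmetric[of "n - j" "2 * n"] by (simp add: algebra_simps)

text \<open>Binomial expansion of (e^(i\<theta>) + e^(-i\<theta>))^(2n); the terms n - j and n + j
  have equal coefficients and combine to a cosine.\<close>

lemma cos_power_even:
  "(2 * cos \<theta>) ^ (2 * n) =
     real (2 * n choose n) + 2 * (\<Sum>j=1..n. real (2 * n choose (n - j)) * cos (2 * real j * \<theta>))"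
proof -
  let ?F = "\<lambda>k. real (2 * n choose k) * cos ((2 * real k - 2 * real n) * \<theta>)"
  have eq: "cis \<theta> ^ k * cis (- \<theta>) ^ (2 * n - k) = cis ((2 * real k - 2 * real n) * \<theta>)" if "k \<le> 2 * n" for k
  proof -
    have "real k * \<theta> + real (2 * n - k) * - \<theta> = (2 * real k - 2 * real n) * \<theta>"
      using that by (simp add: of_nat_diff algebra_simps)
    then show ?thesis
      by (simp only: Complex.DeMoivre cis_mult)
  qed
  have "complex_of_real ((2 * cos \<theta>) ^ (2 * n)) = (cis \<theta> + cis (- \<theta>)) ^ (2 * n)"
    unfolding of_real_power by (rule arg_cong[where f = "\<lambda>x. x ^ (2 * n)"]) (simp add: complex_eq_iff)
  also have "\<dots> = (\<Sum>k\<le>2 * n. of_nat (2 * n choose k) * cis ((2 * real k - 2 * real n) * \<theta>))"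
    unfolding binomial_ring by (intro sum.cong refl) (simp only: mult.assoc atMost_iff eq)
  finally have "Re (complex_of_real ((2 * cos \<theta>) ^ (2 * n))) = Re \<dots>"
    by (rule arg_cong)
  then have "(2 * cos \<theta>) ^ (2 * n) = (\<Sum>k\<le>2 * n. ?F k)"
    by (simp only: Re_complex_of_real Re_sum) simp
  also have "\<dots> = ?F n + (\<Sum>j=1..n. ?F (n - j) + ?F (n + j))"
    by (rule sum_atMost_double_fold)
  also have "(\<Sum>j=1..n. ?F (n - j) + ?F (n + j))
           = (\<Sum>j=1..n. 2 * (real (2 * n choose (n - j)) * cos (2 * real j * \<theta>)))"
  proof (intro sum.cong refl)
    fix j assume "j \<in> {1..n}"
    then have j: "j \<le> n"
      by simp
    have "cos ((2 * real (n - j) - 2 * real n) * \<theta>) = cos (2 * real j * \<theta>)"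
      using j cos_minus[of "2 * real j * \<theta>"] by (simp add: of_nat_diff algebra_simps)
    moreover have "cos ((2 * real (n + j) - 2 * real n) * \<theta>) = cos (2 * real j * \<theta>)"
      by (simp add: algebra_simps)
    ultimately show "?F (n - j) + ?F (n + j) = 2 * (real (2 * n choose (n - j)) * cos (2 * real j * \<theta>))"
      by (simp only: binomial_central_symmetric[OF j])
  qed
  finally show ?thesis
    by (simp add: sum_distrib_left)
qed

lemma summable_bessel_J:
  "summable (\<lambda>m. (-1) ^ m / (fact m * fact (m + n)) * (x / 2) ^ (2 * m + n) :: real)"
proof (rule summable_comparison_test')
  show "summable (\<lambda>m. \<bar>x / 2\<bar> ^ n * (inverse (fact m) * ((x / 2)\<^sup>2) ^ m))"
    by (intro summable_mult summable_exp)
  fix m :: nat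
  have "inverse (fact (m + n)) \<le> (1 :: real)"
    by (simp add: inverse_le_1_iff fact_ge_1)
  then have "\<bar>x / 2\<bar> ^ n * (inverse (fact m) * ((x / 2)\<^sup>2) ^ m) * inverse (fact (m + n))
      \<le> \<bar>x / 2\<bar> ^ n * (inverse (fact m) * ((x / 2)\<^sup>2) ^ m)"
    by (intro mult_left_le) auto
  also have "\<bar>x / 2\<bar> ^ n * (inverse (fact m) * ((x / 2)\<^sup>2) ^ m) * inverse (fact (m + n))
    = norm ((-1) ^ m / (fact m * fact (m + n)) * (x / 2) ^ (2 * m + n))"
  proof -
    have "norm ((-1) ^ m / (fact m * fact (m + n)) * (x / 2) ^ (2 * m + n))
        = \<bar>x / 2\<bar> ^ (2 * m + n) / (fact m * fact (m + n))"
      by (simp add: abs_mult power_abs)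
    moreover have "\<bar>x / 2\<bar> ^ (2 * m + n) = \<bar>x / 2\<bar> ^ n * ((x / 2)\<^sup>2) ^ m"
      unfolding power_add power_mult power2_abs by (rule mult.commute)
    ultimately show ?thesis
      by (simp only: divide_inverse inverse_mult_distrib ac_simps)
  qed
  finally show "norm ((-1) ^ m / (fact m * fact (m + n)) * (x / 2) ^ (2 * m + n))
      \<le> \<bar>x / 2\<bar> ^ n * (inverse (fact m) * ((x / 2)\<^sup>2) ^ m)" .
qed

text \<open>The Bessel series reindexed by n = m + j, so that term n carries z^(2n). Since 1 /
  ((n-j)! (n+j)!) = (2n choose (n-j)) / (2n)!, the coefficients are exactly those that
  \<open>cos_power_even\<close> produces from the cosine series.\<close>

lemma bessel_J_even_sums:
  "(\<lambda>n. if j \<le> n then (-1) ^ n * (z / 2) ^ (2 * n) / fact (2 * n) * real (2 * n choose (n - j)) else 0)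
     sums ((-1) ^ j * bessel_J (2 * j) z)" (is "?s sums _")
proof -
  have "?s (m + j) = (-1) ^ j * ((-1) ^ m / (fact m * fact (m + 2 * j)) * (z / 2) ^ (2 * m + 2 * j))" for m
  proof -
    have "real (2 * (m + j) choose m) = fact (2 * (m + j)) / (fact m * fact (m + 2 * j))"
      by (subst binomial_fact) (auto simp: algebra_simps)
    then show ?thesis
      by (simp add: power_add algebra_simps)
  qed
  then have "(\<lambda>m. ?s (m + j)) sums ((-1) ^ j * bessel_J (2 * j) z)"
    unfolding bessel_J_def
    by (simp only:) (intro sums_mult summable_sums summable_bessel_J)
  then show ?thesis
    by (subst (asm) sums_zero_iff_shift) auto
qed

lemma power_div_fact_le_exp:
  assumes "0 \<le> (x :: real)"
  shows "x ^ n / fact n \<le> exp x"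
proof -
  have "(\<Sum>k\<in>{n}. inverse (fact k) * x ^ k) \<le> (\<Sum>k. inverse (fact k) * x ^ k)"
    using assms by (intro sum_le_suminf summable_exp) auto
  then show ?thesis
    by (simp add: exp_def divide_inverse mult.commute scaleR_conv_of_real)
qed

text \<open>The Stirling-type bound n! >= (n/3)^n, from n^n / n! <= e^n and e <= 3.\<close>

lemma power_div_fact_le:
  assumes "0 \<le> z" "n > 0"
  shows "z ^ n / fact n \<le> (3 * z / real n) ^ n"
proof -
  have "real n ^ n / fact n \<le> exp (real n)"
    by (rule power_div_fact_le_exp) simp
  also have "\<dots> = exp 1 ^ n"
    by (simp flip: exp_of_nat_mult)
  also have "\<dots> \<le> 3 ^ n"
    by (intro power_mono exp_le) auto
  finally have "real n ^ n \<le> 3 ^ n * fact n"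
    by (simp add: field_simps)
  then have "z ^ n * real n ^ n \<le> z ^ n * (3 ^ n * fact n)"
    using assms by (intro mult_left_mono) auto
  then show ?thesis
    using assms by (simp add: power_divide power_mult_distrib field_simps)
qed

text \<open>Expanding the powers in the cosine series by \<open>cos_power_even\<close> and keeping only the frequencies
  up to \<open>D\<close> gives the truncated Jacobi-Anger expansion; only the terms of degree above \<open>D\<close> change.\<close>

lemma jacobi_anger_truncation:
  assumes D: "D > 0" "even D" and z: "0 \<le> z" "6 * z \<le> real D" and x: "x \<in> {-1..1}"
  shows "\<bar>bessel_J 0 z + 2 * (\<Sum>j=1..D div 2. (-1) ^ j * bessel_J (2 * j) z * poly (chebyshev_T (2 * j)) x)
           - cos (z * x)\<bar> \<le> 2 * (3 * z / real D) ^ D"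
proof -
  define \<theta> where "\<theta> = arccos x"
  define M where "M = D div 2"
  have M: "D = 2 * M"
    using D by (simp add: M_def)
  have x\<theta>: "x = cos \<theta>"
    using x by (simp add: \<theta>_def)
  \<comment> \<open>\<open>t n * (2 * cos \<theta>) ^ (2 * n)\<close> is the n-th term of the cosine
    series of \<open>z * x\<close>, and \<open>s j n\<close> is the share of that term belonging to
    frequency 2j.\<close>
  define t where "t n = (-1) ^ n * (z / 2) ^ (2 * n) / fact (2 * n)" for n :: nat
  define s where "s j n = (if j \<le> n then t n * real (2 * n choose (n - j)) else 0)" for j n :: nat
  have s: "s j sums ((-1) ^ j * bessel_J (2 * j) z)" for j
    unfolding s_def t_def by (rule bessel_J_even_sums)
  have Tj: "poly (chebyshev_T (2 * j)) x = cos (2 * real j * \<theta>)" for j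
    by (simp add: x\<theta> poly_chebyshev_T_cos)
  have tr: "(\<lambda>n. s 0 n + 2 * (\<Sum>j=1..M. s j n * cos (2 * real j * \<theta>))) sums
     ((-1) ^ 0 * bessel_J (2 * 0) z
       + 2 * (\<Sum>j=1..M. (-1) ^ j * bessel_J (2 * j) z * cos (2 * real j * \<theta>)))"
    by (intro sums_add sums_mult sums_sum sums_mult2 s)
  have cs: "(\<lambda>n. t n * (2 * cos \<theta>) ^ (2 * n)) sums cos (z * x)"
  proof -
    have "t n * (2 * cos \<theta>) ^ (2 * n) = (-1) ^ n * (z * x) ^ (2 * n) / fact (2 * n)" for n
      by (simp add: t_def x\<theta> power_mult_distrib power_divide)
    then show ?thesis
      using cos_paired[of "z * x"] by (simp add: mult.commute)
  qed
  have *: "(\<lambda>n. s 0 n + 2 * (\<Sum>j=1..M. s j n * cos (2 * real j * \<theta>)) - t n * (2 * cos \<theta>) ^ (2 * n)) sums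
     (bessel_J 0 z + 2 * (\<Sum>j=1..D div 2. (-1) ^ j * bessel_J (2 * j) z * poly (chebyshev_T (2 * j)) x)
       - cos (z * x))" (is "?d sums ?e")
    using sums_diff[OF tr cs] unfolding Tj M_def[symmetric] by simp
  define q where "q = 3 * z / real D"
  have q: "0 \<le> q" "q \<le> 1/2"
    using z D by (auto simp: q_def field_simps)
  have full: "t n * (2 * cos \<theta>) ^ (2 * n) = s 0 n + 2 * (\<Sum>j=1..n. s j n * cos (2 * real j * \<theta>))" for n
  proof -
    have "t n * (\<Sum>j=1..n. real (2 * n choose (n - j)) * cos (2 * real j * \<theta>)) = (\<Sum>j=1..n. s j n * cos (2 * real j * \<theta>))"
      unfolding sum_distrib_left by (intro sum.cong) (auto simp: s_def)
    then show ?thesis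
      unfolding cos_power_even distrib_left by (simp add: s_def)
  qed
  \<comment> \<open>For n <= M the n-th cosine term contains no frequency above 2M = D, so
    truncation leaves it intact.\<close>
  have zero: "?d n = 0" if "n < Suc M" for n
  proof -
    have "(\<Sum>j=1..M. s j n * cos (2 * real j * \<theta>)) = (\<Sum>j=1..n. s j n * cos (2 * real j * \<theta>))"
      using that by (intro sum.mono_neutral_right) (auto simp: s_def)
    then show ?thesis
      unfolding full by simp
  qed
  have bound: "norm (?d n) \<le> q ^ (2 * n)" if n: "n \<ge> Suc M" for n
  proof -
    have "(\<Sum>j=1..n. s j n * cos (2 * real j * \<theta>))
        = (\<Sum>j=1..M. s j n * cos (2 * real j * \<theta>)) + (\<Sum>j=Suc M..n. s j n * cos (2 * real j * \<theta>))"
      using n by (subst sum.union_disjoint[symmetric]) (auto intro!: sum.cong)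
    then have "norm (?d n) = 2 * \<bar>\<Sum>j=Suc M..n. s j n * cos (2 * real j * \<theta>)\<bar>"
      unfolding full by simp
    also have "\<bar>\<Sum>j=Suc M..n. s j n * cos (2 * real j * \<theta>)\<bar> \<le> (\<Sum>j=Suc M..n. \<bar>t n\<bar> * real (2 * n choose (n - j)))"
      by (intro order.trans[OF sum_abs] sum_mono) (auto simp: s_def abs_mult intro!: mult_left_le)
    also have "\<dots> \<le> (\<Sum>j=1..n. \<bar>t n\<bar> * real (2 * n choose (n - j)))"
      by (intro sum_mono2) auto
    \<comment> \<open>\<open>cos_power_even\<close> at angle 0: the binomial coefficients sum to
      2^(2n), which cancels the halves in (z/2)^(2n).\<close>
    also have "2 * (\<Sum>j=1..n. \<bar>t n\<bar> * real (2 * n choose (n - j))) \<le> \<bar>t n\<bar> * (2 * cos 0) ^ (2 * n)"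
      unfolding cos_power_even by (simp add: distrib_left sum_distrib_left mult_ac)
    also have "\<dots> = z ^ (2 * n) / fact (2 * n)"
      using z by (simp add: t_def abs_mult power_divide power_abs)
    also have "\<dots> \<le> (3 * z / real (2 * n)) ^ (2 * n)"
      using n z by (intro power_div_fact_le) auto
    also have "\<dots> \<le> q ^ (2 * n)"
      unfolding q_def using n z D M by (intro power_mono divide_left_mono) auto
    finally show ?thesis
      by simp
  qed
  have q2: "q\<^sup>2 \<le> 1/4"
    using power_mono[OF q(2,1), of 2] by (simp add: power2_eq_square)
  have "norm ?e \<le> q ^ D * (1 / (1 - q\<^sup>2))"
  proof -
    have "(\<lambda>m. ?d (m + Suc M)) sums ?e"
      using * sums_zero_iff_shift[of "Suc M" ?d, OF zero] by blast
    moreover have "(\<lambda>m. q ^ D * (q\<^sup>2) ^ m) sums (q ^ D * (1 / (1 - q\<^sup>2)))"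
      using q2 q by (intro sums_mult geometric_sums) auto
    moreover have "norm (?d (m + Suc M)) \<le> q ^ D * (q\<^sup>2) ^ m" for m
    proof -
      have "norm (?d (m + Suc M)) \<le> q ^ (2 * (m + Suc M))"
        by (rule bound) simp
      also have "\<dots> \<le> q ^ (D + 2 * m)"
        using q M by (intro power_decreasing) auto
      finally show ?thesis
        by (simp add: power_add power_mult)
    qed
    ultimately show ?thesis
      by (rule norm_sums_le)
  qed
  also have "\<dots> \<le> q ^ D * 2"
    using q q2 by (intro mult_left_mono) (auto simp: field_simps)
  finally show ?thesis
    by (simp add: q_def mult.commute)
qed

section \<open>Fourier inversion\<close>

lemma borel_measurable_cis [measurable]: "f \<in> borel_measurable M \<Longrightarrow> (\<lambda>x. cis (f x)) \<in> borel_measurable M"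
  by (rule borel_measurable_continuous_on[of cis]) (auto intro!: continuous_intros)

lemma integrable_cis_mult:
  assumes "integrable lborel g" "f \<in> borel_measurable lborel"
  shows "integrable lborel (\<lambda>x. complex_of_real (g x) * cis (f x))"
  using assms by (intro Bochner_Integration.integrable_bound[OF assms(1)]) (auto simp: norm_mult)

text \<open>The characteristic function of the standard normal law, rescaled by the substitution v =
  c y.\<close>

lemma std_normal_density_fourier:
  assumes "c > 0"
  shows "(LINT y|lborel. complex_of_real (std_normal_density (c * y)) * cis (2 * pi * y * s)) =
           complex_of_real (sqrt (2 * pi) / c * std_normal_density (2 * pi * s / c))"
proof -
  have "(LINT v|lborel. complex_of_real (std_normal_density v) * cis (t * v)) = complex_of_real (exp (- (t\<^sup>2) / 2))" for t
  proof -
    have "(LINT v|lborel. complex_of_real (std_normal_density v) * cis (t * v)) = char std_normal_distribution t"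
      unfolding char_def
      by (subst integral_density) (auto simp: scaleR_conv_of_real cis_conv_exp mult_ac)
    then show ?thesis
      by (simp add: char_std_normal_distribution)
  qed
  from this[of "2 * pi * s / c"]
  have "complex_of_real (exp (- ((2 * pi * s / c)\<^sup>2) / 2))
      = (LINT v|lborel. complex_of_real (std_normal_density v) * cis (2 * pi * s / c * v))" ..
  also have "\<dots> = \<bar>c\<bar> *\<^sub>R (LINT y|lborel. complex_of_real (std_normal_density (0 + c * y)) * cis (2 * pi * s / c * (0 + c * y)))"
    using assms by (intro lborel_integral_real_affine) auto
  also have "(\<lambda>y. complex_of_real (std_normal_density (0 + c * y)) * cis (2 * pi * s / c * (0 + c * y)))
      = (\<lambda>y. complex_of_real (std_normal_density (c * y)) * cis (2 * pi * y * s))"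
    using assms by (auto simp: mult_ac)
  finally show ?thesis
    using assms by (simp add: std_normal_density_def scaleR_conv_of_real field_simps)
qed

lemma std_normal_density_le: "std_normal_density x \<le> 1"
proof -
  have "1 \<le> sqrt (2 * pi)"
    using pi_ge_two by simp
  then have "1 / sqrt (2 * pi) \<le> 1"
    by simp
  then have "1 / sqrt (2 * pi) * exp (- x\<^sup>2 / 2) \<le> 1 * 1"
    by (intro mult_mono) auto
  then show ?thesis
    by (simp add: std_normal_density_def)
qed

lemma isCont_std_normal_density: "isCont std_normal_density x"
  unfolding std_normal_density_def[abs_def] by (intro continuous_intros) auto

text \<open>Damping the inner integral by a Gaussian of width \<open>1/\<delta>\<close> justifies Fubini and turns the iterated
  integral into the convolution of \<open>g\<close> with an approximate identity; both sides converge as \<open>\<delta> \<rightarrow> 0\<close>.\<close>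

lemma fourier_inversion:
  fixes g :: "real \<Rightarrow> real"
  defines "f \<equiv> \<lambda>y. LINT \<xi>|lborel. complex_of_real (g \<xi>) * cis (2 * pi * y * \<xi>)"
  assumes g: "integrable lborel g" "\<And>x. isCont g x" "\<And>x. \<bar>g x\<bar> \<le> B"
    and f: "integrable lborel f"
  shows "(LINT y|lborel. f y * cis (- (2 * pi * x * y))) = complex_of_real (g x)"
proof -
  define \<delta> where "\<delta> n = 1 / real (Suc n)" for n
  have \<delta>: "\<delta> n > 0" "\<delta> \<longlonglongrightarrow> 0" for n
    unfolding \<delta>_def using lim_1_over_n[THEN LIMSEQ_Suc] by auto
  note [measurable] = borel_measurable_integrable[OF g(1)] borel_measurable_integrable[OF f]
  define A where "A n = (LINT y|lborel. f y * cis (- (2 * pi * x * y)) * complex_of_real (std_normal_density (\<delta> n * y)))" for n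
  have limA: "A \<longlonglongrightarrow> (LINT y|lborel. f y * cis (- (2 * pi * x * y)) * complex_of_real (std_normal_density 0))"
    unfolding A_def
  proof (rule integral_dominated_convergence[where w = "\<lambda>y. norm (f y)"])
    show "AE y in lborel. (\<lambda>n. f y * cis (- (2 * pi * x * y)) * complex_of_real (std_normal_density (\<delta> n * y)))
      \<longlonglongrightarrow> f y * cis (- (2 * pi * x * y)) * complex_of_real (std_normal_density 0)"
      using \<delta>(2) by (intro always_eventually allI tendsto_intros isCont_tendsto_compose[OF isCont_std_normal_density])
         (rule tendsto_mult_left_zero)
  qed (use f std_normal_density_le in \<open>auto simp: norm_mult intro!: mult_left_le\<close>)
  have A_eq: "A n = (LINT u|lborel. complex_of_real (g (x + \<delta> n / (2 * pi) * u) * std_normal_density u)) / sqrt (2 * pi)" for n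
  proof -
    let ?h = "\<lambda>\<xi> y. (complex_of_real (g \<xi>) * cis (2 * pi * y * \<xi>))
        * (cis (- (2 * pi * x * y)) * complex_of_real (std_normal_density (\<delta> n * y)))"
    have N: "integrable lborel (\<lambda>y. std_normal_density (\<delta> n * y))"
      using lborel_integrable_real_affine[OF integrable_normal_density[of 1 0], of "\<delta> n" 0] \<delta>(1)[of n] by simp
    have "A n = (LINT y|lborel. (LINT \<xi>|lborel. ?h \<xi> y))"
      unfolding A_def f_def integral_mult_left_zero by (simp only: mult.assoc)
    \<comment> \<open>The Gaussian supplies integrability in y and \<open>g\<close> in \<xi>, so the
      product is absolutely integrable.\<close>
    also have "\<dots> = (LINT \<xi>|lborel. (LINT y|lborel. ?h \<xi> y))"
    proof (rule lborel_pair.Fubini_integral, rule lborel_pair.Fubini_integrable)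
      have "(\<lambda>\<xi>. LINT y|lborel. norm (case_prod ?h (\<xi>, y)))
          = (\<lambda>\<xi>. \<bar>g \<xi>\<bar> * (LINT y|lborel. std_normal_density (\<delta> n * y)))"
        by (simp add: norm_mult)
      then show "integrable lborel (\<lambda>\<xi>. LINT y|lborel. norm (case_prod ?h (\<xi>, y)))"
        using g(1) by (simp add: integrable_abs)
      show "AE \<xi> in lborel. integrable lborel (\<lambda>y. case_prod ?h (\<xi>, y))"
      proof (intro always_eventually allI)
        fix \<xi>
        have "integrable lborel (\<lambda>y. g \<xi> * std_normal_density (\<delta> n * y))"
          using N by simp
        then show "integrable lborel (\<lambda>y. case_prod ?h (\<xi>, y))"
          by (rule Bochner_Integration.integrable_bound) (auto simp: norm_mult abs_mult)
      qed
    qed measurable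
    also have "\<dots> = (LINT \<xi>|lborel. complex_of_real (g \<xi> * (sqrt (2 * pi) / \<delta> n * std_normal_density (2 * pi * (\<xi> - x) / \<delta> n))))"
    proof (rule Bochner_Integration.integral_cong[OF refl])
      fix \<xi>
      have eq: "?h \<xi> y = complex_of_real (g \<xi>) * (complex_of_real (std_normal_density (\<delta> n * y)) * cis (2 * pi * y * (\<xi> - x)))" for y
      proof -
        have *: "cis (2 * pi * y * \<xi>) * cis (- (2 * pi * x * y)) = cis (2 * pi * y * (\<xi> - x))"
          by (simp add: cis_mult algebra_simps)
        show ?thesis
          unfolding *[symmetric] by (simp only: ac_simps)
      qed
      show "(LINT y|lborel. ?h \<xi> y) = complex_of_real (g \<xi> * (sqrt (2 * pi) / \<delta> n * std_normal_density (2 * pi * (\<xi> - x) / \<delta> n)))"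
        by (simp only: eq integral_mult_right_zero std_normal_density_fourier[OF \<delta>(1)] of_real_mult)
    qed
    \<comment> \<open>The substitution \<xi> = x + \<delta> u / (2 pi) moves the shrinking width
      from the kernel into the argument of \<open>g\<close>, where continuity at x can be
      used.\<close>
    also have "\<dots> = \<bar>\<delta> n / (2 * pi)\<bar> *\<^sub>R (LINT u|lborel. complex_of_real (g (x + \<delta> n / (2 * pi) * u) *
        (sqrt (2 * pi) / \<delta> n * std_normal_density (2 * pi * (x + \<delta> n / (2 * pi) * u - x) / \<delta> n))))"
      using \<delta>(1)[of n] by (intro lborel_integral_real_affine) auto
    also have "\<dots> = \<bar>\<delta> n / (2 * pi)\<bar> *\<^sub>R (LINT u|lborel. complex_of_real (sqrt (2 * pi) / \<delta> n) *
        complex_of_real (g (x + \<delta> n / (2 * pi) * u) * std_normal_density u))"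
      using \<delta>(1)[of n] by (intro arg_cong2[of _ _ _ _ scaleR] refl Bochner_Integration.integral_cong) auto
    also have "\<dots> = complex_of_real (\<bar>\<delta> n / (2 * pi)\<bar> * (sqrt (2 * pi) / \<delta> n)) *
        (LINT u|lborel. complex_of_real (g (x + \<delta> n / (2 * pi) * u) * std_normal_density u))"
      by (simp add: scaleR_conv_of_real)
    also have "\<bar>\<delta> n / (2 * pi)\<bar> * (sqrt (2 * pi) / \<delta> n) = 1 / sqrt (2 * pi)"
      using \<delta>(1)[of n] by (simp add: real_div_sqrt field_simps flip: power2_eq_square)
    finally show ?thesis
      by simp
  qed
  have lim: "(\<lambda>n. LINT u|lborel. complex_of_real (g (x + \<delta> n / (2 * pi) * u) * std_normal_density u))
     \<longlonglongrightarrow> (LINT u|lborel. complex_of_real (g x * std_normal_density u))"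
  proof (rule integral_dominated_convergence[where w = "\<lambda>u. B * std_normal_density u"])
    show "AE u in lborel. (\<lambda>n. complex_of_real (g (x + \<delta> n / (2 * pi) * u) * std_normal_density u))
      \<longlonglongrightarrow> complex_of_real (g x * std_normal_density u)"
    proof (intro always_eventually allI tendsto_intros isCont_tendsto_compose[OF g(2)])
      show "(\<lambda>n. x + \<delta> n / (2 * pi) * u) \<longlonglongrightarrow> x" for u
        using tendsto_add[OF tendsto_const[of x] tendsto_mult[OF tendsto_divide[OF \<delta>(2) tendsto_const[of "2 * pi"]] tendsto_const[of u]]]
        by simp
    qed
    show "AE u in lborel. norm (complex_of_real (g (x + \<delta> n / (2 * pi) * u) * std_normal_density u)) \<le> B * std_normal_density u" for n
      using g(3) by (auto simp: norm_mult abs_mult intro!: mult_right_mono)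
  qed auto
  have "A \<longlonglongrightarrow> (LINT u|lborel. complex_of_real (g x * std_normal_density u)) / sqrt (2 * pi)"
    unfolding A_eq[abs_def] by (intro tendsto_divide lim tendsto_const) auto
  \<comment> \<open>The damping factor tends to its value at 0, namely 1 / sqrt (2 pi), which
    cancels against the same factor in the other limit.\<close>
  from LIMSEQ_unique[OF limA this] show ?thesis
    by (simp add: std_normal_density_def[of 0])
qed

section \<open>The target and its Fourier transform\<close>

lemma target_nonneg: "0 \<le> target \<tau> \<beta> x"
  by (simp add: target_def)

lemma target_le_1: "\<tau> > 0 \<Longrightarrow> target \<tau> \<beta> x \<le> 1"
  by (simp add: target_def)

lemma target_minus: "target \<tau> \<beta> (- x) = target \<tau> \<beta> x"
  by (simp add: target_def)

lemma isCont_target: "\<beta> > 0 \<Longrightarrow> isCont (target \<tau> \<beta>) x"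
  unfolding target_def[abs_def]
  by (rule continuous_on_interior[of UNIV], intro continuous_intros continuous_on_powr') auto

lemma borel_measurable_target [measurable]: "target \<tau> \<beta> \<in> borel_measurable borel"
  unfolding target_def[abs_def] by measurable

text \<open>Bounding exp v below by v^n / n! with v = \<tau> |x|^\<beta> and n > 2/\<beta> gives a
  decay of order x^(-2), hence domination by a multiple of 1 / (1 + x^2).\<close>

lemma integrable_target:
  assumes "\<tau> > 0" "\<beta> > 0"
  shows "integrable lborel (target \<tau> \<beta>)"
proof -
  obtain n where n: "real n > 2 / \<beta>"
    using reals_Archimedean2 by blast
  define K where "K = max 1 (fact n / \<tau> ^ n)"
  have "integrable lborel (\<lambda>x::real. 2 * K * inverse (1 + x\<^sup>2))"
    using integrable_inverse_1_plus_square by (simp add: set_integrable_def)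
  then show ?thesis
  proof (rule Bochner_Integration.integrable_bound)
    have "target \<tau> \<beta> x \<le> 2 * K * inverse (1 + x\<^sup>2)" for x
    proof (cases "\<bar>x\<bar> \<le> 1")
      case True
      then have "x\<^sup>2 \<le> 1"
        by (simp add: abs_square_le_1)
      then have "1 \<le> 2 * inverse (1 + x\<^sup>2)"
        by (simp add: field_simps add_pos_nonneg)
      moreover have "2 * inverse (1 + x\<^sup>2) \<le> K * (2 * inverse (1 + x\<^sup>2))"
        by (intro mult_right_mono[of 1 K, simplified]) (auto simp: K_def)
      ultimately show ?thesis
        using target_le_1[OF assms(1), of \<beta> x] by linarith
    next
      case False
      then have x: "\<bar>x\<bar> > 1"
        by simp
      then have x2: "x\<^sup>2 \<ge> 1"
        by (metis less_imp_le one_le_power power2_abs)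
      have "2 \<le> \<beta> * real n"
        using n assms by (simp add: field_simps)
      then have "x\<^sup>2 \<le> (\<bar>x\<bar> powr \<beta>) ^ n"
        using x powr_mono[of 2 "\<beta> * real n" "\<bar>x\<bar>"] by (simp add: powr_powr flip: powr_realpow)
      then have "\<tau> ^ n * x\<^sup>2 \<le> (\<tau> * \<bar>x\<bar> powr \<beta>) ^ n"
        using assms by (simp add: power_mult_distrib)
      also have "\<dots> \<le> fact n * exp (\<tau> * \<bar>x\<bar> powr \<beta>)"
        using power_div_fact_le_exp[of "\<tau> * \<bar>x\<bar> powr \<beta>" n] assms by (simp add: field_simps)
      finally have "target \<tau> \<beta> x \<le> fact n / \<tau> ^ n * inverse (x\<^sup>2)"
        using assms x by (simp add: target_def exp_minus field_simps)
      also have "\<dots> \<le> K * inverse (x\<^sup>2)"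
        by (intro mult_right_mono) (auto simp: K_def)
      also have "\<dots> \<le> K * inverse ((1 + x\<^sup>2) / 2)"
        using x2 by (intro mult_left_mono le_imp_inverse_le) (auto simp: K_def add_pos_nonneg)
      finally show ?thesis
        by (simp only: inverse_divide) (simp only: divide_inverse ac_simps)
    qed
    then have "norm (target \<tau> \<beta> x) \<le> norm (2 * K * inverse (1 + x\<^sup>2))" for x
      using abs_ge_self[of "2 * K * inverse (1 + x\<^sup>2)"] order.trans target_nonneg
      by (fastforce simp del: inverse_mult_distrib)
    then show "AE x in lborel. norm (target \<tau> \<beta> x) \<le> norm (2 * K * inverse (1 + x\<^sup>2))"
      by simp
  qed auto
qed

lemma integrable_target_cos:
  assumes "\<tau> > 0" "\<beta> > 0"
  shows "integrable lborel (\<lambda>\<xi>. target \<tau> \<beta> \<xi> * cos (c * \<xi>))"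
  by (rule Bochner_Integration.integrable_bound[OF integrable_target[OF assms]])
     (auto simp: abs_mult target_nonneg intro!: mult_left_le)

lemma target_ft_eq_cos:
  assumes "\<tau> > 0" "\<beta> > 0"
  shows "target_ft \<tau> \<beta> y = (LINT \<xi>|lborel. target \<tau> \<beta> \<xi> * cos (2 * pi * y * \<xi>))"
proof -
  have "integrable lborel (\<lambda>\<xi>. complex_of_real (target \<tau> \<beta> \<xi>) * cis (2 * pi * y * \<xi>))"
    by (intro integrable_cis_mult integrable_target assms) simp
  then show ?thesis
    unfolding target_ft_def by (subst integral_Re[symmetric]) auto
qed

lemma target_ft_minus:
  assumes "\<tau> > 0" "\<beta> > 0"
  shows "target_ft \<tau> \<beta> (- y) = target_ft \<tau> \<beta> y"
  by (simp add: target_ft_eq_cos[OF assms])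

lemma isCont_target_ft:
  assumes "\<tau> > 0" "\<beta> > 0"
  shows "isCont (target_ft \<tau> \<beta>) y"
  unfolding continuous_at_sequentially comp_def
proof (intro allI impI)
  fix X assume X: "X \<longlonglongrightarrow> y"
  show "(\<lambda>n. target_ft \<tau> \<beta> (X n)) \<longlonglongrightarrow> target_ft \<tau> \<beta> y"
    unfolding target_ft_eq_cos[OF assms]
  proof (rule integral_dominated_convergence[where w = "target \<tau> \<beta>"])
    show "AE \<xi> in lborel. (\<lambda>n. target \<tau> \<beta> \<xi> * cos (2 * pi * X n * \<xi>)) \<longlonglongrightarrow> target \<tau> \<beta> \<xi> * cos (2 * pi * y * \<xi>)"
      by (intro always_eventually allI tendsto_intros X)
  qed (auto intro!: integrable_target assms mult_left_le simp: abs_mult target_nonneg)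
qed

section \<open>Folding, truncation and contour shifts\<close>

lemma lborel_integral_even:
  fixes h :: "real \<Rightarrow> real"
  assumes h: "integrable lborel h" and even: "\<And>x. h (- x) = h x"
  shows "(LINT x|lborel. h x) = 2 * (LINT x:{0..}|lborel. h x)"
proof -
  note [measurable] = borel_measurable_integrable[OF h]
  have i: "set_integrable lborel A h" if "A \<in> sets lborel" for A
    unfolding set_integrable_def using that by (intro integrable_mult_indicator h)
  have "(LINT x|lborel. h x) = (LINT x:{0..} \<union> {..<0}|lborel. h x)"
    unfolding set_lebesgue_integral_def by (intro Bochner_Integration.integral_cong) (auto simp: indicator_def)
  also have "\<dots> = (LINT x:{0..}|lborel. h x) + (LINT x:{..<0}|lborel. h x)"
    by (intro set_integral_Un i) auto
  also have "(LINT x:{..<0}|lborel. h x) = (LINT x|lborel. indicator {..<0} (0 + (-1) * x) * h (0 + (-1) * x))"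
    unfolding set_lebesgue_integral_def
    by (subst lborel_integral_real_affine[where c = "-1" and t = 0]) auto
  also have "\<dots> = (LINT x:{0..}|lborel. h x)"
    unfolding set_lebesgue_integral_def
    using AE_lborel_singleton[of 0] by (intro integral_cong_AE) (auto simp: even indicator_def)
  finally show ?thesis
    by simp
qed

text \<open>The intervals avoid 0 as well as infinity, so that the substitution x = exp u carries
  them to compact intervals in u.\<close>

lemma lborel_integral_even_limit:
  fixes h :: "real \<Rightarrow> real"
  assumes h: "integrable lborel h" and even: "\<And>x. h (- x) = h x"
  shows "(\<lambda>n. 2 * (LINT x:{1 / real (Suc n)..real (Suc n)}|lborel. h x)) \<longlonglongrightarrow> (LINT x|lborel. h x)"
  unfolding lborel_integral_even[OF assms]
proof (intro tendsto_intros)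
  note [measurable] = borel_measurable_integrable[OF h]
  show "(\<lambda>n. LINT x:{1 / real (Suc n)..real (Suc n)}|lborel. h x) \<longlonglongrightarrow> (LINT x:{0..}|lborel. h x)"
    unfolding set_lebesgue_integral_def
  proof (rule integral_dominated_convergence[where w = "\<lambda>x. \<bar>h x\<bar>"])
    show "AE x in lborel. (\<lambda>n. indicat_real {1 / real (Suc n)..real (Suc n)} x *\<^sub>R h x) \<longlonglongrightarrow> indicat_real {0..} x *\<^sub>R h x"
      using AE_lborel_singleton[of 0]
    proof eventually_elim
      case (elim x)
      have "eventually (\<lambda>n. indicat_real {1 / real (Suc n)..real (Suc n)} x = indicat_real {0..} x) sequentially"
      proof (cases "x < 0")
        case True
        then have "\<not> 1 / real (Suc n) \<le> x" for n
          by (meson divide_nonneg_nonneg not_less of_nat_0_le_iff order.strict_trans2 zero_le_one)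
        with True show ?thesis
          by (intro always_eventually) (auto simp: indicator_def)
      next
        case False
        obtain N where N: "real N > max x (1 / x)"
          using reals_Archimedean2 by blast
        have "indicat_real {1 / real (Suc n)..real (Suc n)} x = indicat_real {0..} x" if "n \<ge> N" for n
        proof -
          have "max x (1 / x) \<le> real (Suc n)"
            using N that by (auto simp del: max_less_iff_conj)
          then show ?thesis
            using False elim by (auto simp: indicator_def field_simps)
        qed
        then show ?thesis
          by (auto simp: eventually_sequentially)
      qed
      then show ?case
        by (intro tendsto_eventually) (auto elim!: eventually_mono)
    qed
  qed (use h in \<open>auto simp: indicator_def\<close>)
qed

text \<open>Cauchy's theorem for a rectangle: an entire function has a global primitive, so the two
  horizontal integrals differ by increments of the primitive along the vertical sides, each at most
  length times maximum.\<close>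

lemma horizontal_integral_shift:
  assumes hol: "G holomorphic_on UNIV" and AB: "A \<le> B" and s: "0 \<le> s"
    and M: "\<And>v. 0 \<le> v \<Longrightarrow> v \<le> s \<Longrightarrow> norm (G (Complex A v)) \<le> M1"
           "\<And>v. 0 \<le> v \<Longrightarrow> v \<le> s \<Longrightarrow> norm (G (Complex B v)) \<le> M2"
  shows "norm (integral {A..B} (\<lambda>u. G (Complex u 0)) - integral {A..B} (\<lambda>u. G (Complex u s))) \<le> s * (M1 + M2)"
proof -
  obtain \<Phi> where \<Phi>: "\<And>z. (\<Phi> has_field_derivative G z) (at z)"
    using holomorphic_convex_primitive'[OF convex_UNIV open_UNIV hol] by auto
  have hor: "((\<lambda>u. G (Complex u v)) has_integral \<Phi> (Complex B v) - \<Phi> (Complex A v)) {A..B}" for v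
  proof (rule fundamental_theorem_of_calculus[OF AB])
    fix u
    have "((\<lambda>u. Complex u v) has_vector_derivative 1) (at u within {A..B})"
      unfolding Complex_eq by (auto intro!: derivative_eq_intros simp: has_vector_derivative_def fun_eq_iff scaleR_conv_of_real)
    from field_vector_diff_chain_within[OF this, of \<Phi> "G (Complex u v)"] \<Phi>
    show "((\<lambda>u. \<Phi> (Complex u v)) has_vector_derivative G (Complex u v)) (at u within {A..B})"
      by (auto simp: comp_def intro: has_field_derivative_at_within)
  qed
  have ver: "norm (\<Phi> (Complex x 0) - \<Phi> (Complex x s)) \<le> M * s"
    if K: "\<And>v. 0 \<le> v \<Longrightarrow> v \<le> s \<Longrightarrow> norm (G (Complex x v)) \<le> M" for x M
  proof -
    have "norm (\<Phi> (Complex x 0) - \<Phi> (Complex x s)) \<le> M * norm (Complex x 0 - Complex x s)"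
    proof (rule field_differentiable_bound[of "closed_segment (Complex x 0) (Complex x s)"])
      fix z assume "z \<in> closed_segment (Complex x 0) (Complex x s)"
      then obtain t where t: "0 \<le> t" "t \<le> 1" "z = (1 - t) *\<^sub>R Complex x 0 + t *\<^sub>R Complex x s"
        by (auto simp: in_segment)
      have "z = Complex x (t * s)"
        by (simp add: t complex_eq_iff algebra_simps)
      then show "norm (G z) \<le> M"
        using t s K[of "t * s"] by (simp add: mult_left_le_one_le)
    qed (auto intro: \<Phi> has_field_derivative_at_within)
    also have "norm (Complex x 0 - Complex x s) = s"
      using s by (simp add: cmod_def)
    finally show ?thesis .
  qed
  have "norm (integral {A..B} (\<lambda>u. G (Complex u 0)) - integral {A..B} (\<lambda>u. G (Complex u s)))
      = norm ((\<Phi> (Complex B 0) - \<Phi> (Complex B s)) - (\<Phi> (Complex A 0) - \<Phi> (Complex A s)))"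
    unfolding hor[THEN integral_unique] by (simp add: algebra_simps)
  also have "\<dots> \<le> M2 * s + M1 * s"
    by (rule order.trans[OF norm_triangle_ineq4 add_mono[OF ver[OF M(2)] ver[OF M(1)]]])
  finally show ?thesis
    by (simp add: algebra_simps)
qed

section \<open>Decay of the Fourier transform\<close>

text \<open>Lets a power be absorbed by half of an exponential decay, leaving the other half for
  integration.\<close>

lemma powr_le_exp_half:
  fixes \<beta> :: real
  assumes "\<beta> > 0"
  shows "\<exists>K>0. \<forall>u\<ge>0. u powr \<beta> \<le> K * exp (u / 2)"
proof -
  obtain n where n: "real n > \<beta>"
    using reals_Archimedean2 by blast
  have "u powr \<beta> \<le> 2 ^ n * fact n * exp (u / 2)" if u: "u \<ge> 0" for u
  proof (cases "u \<le> 1")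
    case True
    have "u powr \<beta> \<le> 1"
      using True u assms by (metis less_imp_le powr_mono2 powr_one_eq_one)
    also have "1 \<le> 2 ^ n * (fact n :: real)"
      using mult_mono[of 1 "2 ^ n" 1 "fact n :: real"] by (simp add: fact_ge_1)
    also have "\<dots> \<le> \<dots> * exp (u / 2)"
      using u by simp
    finally show ?thesis .
  next
    case False
    then have "u powr \<beta> \<le> u powr real n"
      using n by (intro powr_mono) auto
    also have "\<dots> = u ^ n"
      using False by (simp add: powr_realpow)
    also have "\<dots> \<le> 2 ^ n * fact n * exp (u / 2)"
      using power_div_fact_le_exp[of "u / 2" n] u by (simp add: field_simps power_divide)
    finally show ?thesis .
  qed
  then show ?thesis
    by (intro exI[of _ "2 ^ n * fact n"]) auto
qed

text \<open>The mean value inequality on the left half plane, which is convex and where exp has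
  modulus at most 1.\<close>

lemma norm_exp_minus_one_le:
  fixes w :: complex
  assumes "0 \<le> Re w"
  shows "norm (exp (- w) - 1) \<le> norm w"
proof -
  have "norm (exp (- w) - exp 0) \<le> 1 * norm (- w - 0)"
    by (rule field_differentiable_bound[of "{z. Re z \<le> 0}" exp exp])
       (use assms in \<open>auto simp: convex_halfspace_Re_le DERIV_exp[THEN has_field_derivative_at_within]\<close>)
  then show ?thesis
    by simp
qed

lemma exp_Complex: "exp (Complex u v) = complex_of_real (exp u) * cis v"
  by (simp add: exp_eq_polar)

text \<open>In the coordinate \<open>\<zeta> = ln z\<close> the rotation of the half line by the angle \<open>\<phi>\<close> is a vertical shift, and
  the integrand is entire. On the rotated line, replacing \<open>exp (- \<tau> z^\<beta>)\<close> by \<open>exp (- \<tau> z^\<beta>) - 1\<close> changes only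
  the imaginary part of the integral, and \<open>|exp (- w) - 1| \<le> |w|\<close> yields the factor \<open>\<tau>\<close>.\<close>

lemma target_ft_decay:
  assumes "\<beta> > 0"
  shows "\<exists>C>0. \<forall>\<tau>>0. \<forall>y>0. \<bar>target_ft \<tau> \<beta> y\<bar> \<le> C * \<tau> * y powr (- 1 - \<beta>)"
proof -
  \<comment> \<open>The angle must keep both factors under control: \<phi> <= pi/4 makes exp (2 pi i
    y z) decay on the rotated ray, and \<beta> \<phi> <= pi/4 keeps the real part of z^\<beta>
    positive throughout the sector.\<close>
  define \<phi> where "\<phi> = pi / (4 * (1 + \<beta>))"
  have "\<phi> = pi / 4 * (1 / (1 + \<beta>))" "\<beta> * \<phi> = pi / 4 * (\<beta> / (1 + \<beta>))"
    using assms by (simp_all add: \<phi>_def field_simps)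
  moreover have "1 / (1 + \<beta>) \<le> 1" "\<beta> / (1 + \<beta>) \<le> 1"
    using assms by simp_all
  ultimately have \<phi>: "0 < \<phi>" "\<phi> \<le> pi / 4" "\<beta> * \<phi> \<le> pi / 4"
    using assms mult_left_le[of "1 / (1 + \<beta>)" "pi / 4"] mult_left_le[of "\<beta> / (1 + \<beta>)" "pi / 4"]
    by (auto simp: \<phi>_def mult.commute)
  have sin\<phi>: "sin \<phi> > 0"
    using \<phi> by (intro sin_gt_zero) auto
  obtain K where K: "K > 0" "\<And>u. u \<ge> 0 \<Longrightarrow> u powr \<beta> \<le> K * exp (u / 2)"
    using powr_le_exp_half[OF assms] by blast
  have bd: "\<bar>target_ft \<tau> \<beta> y\<bar> \<le> 4 * K * \<tau> * (2 * pi * y * sin \<phi>) powr (- 1 - \<beta>)" if \<tau>: "\<tau> > 0" and y: "y > 0" for \<tau> y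
  proof -
    \<comment> \<open>The decay rate on the rotated ray: |exp (2 pi i y z)| = exp (- \<sigma> t) at
      z = t cis \<phi>. Below, \<open>w\<close> is \<tau> z^\<beta> and \<open>L\<close> is the
      oscillating factor times the Jacobian exp \<zeta>.\<close>
    define \<sigma> where "\<sigma> = 2 * pi * y * sin \<phi>"
    have \<sigma>: "\<sigma> > 0"
      using y sin\<phi> by (simp add: \<sigma>_def)
    define w where "w \<zeta> = complex_of_real \<tau> * exp (complex_of_real \<beta> * \<zeta>)" for \<zeta>
    define L where "L \<zeta> = exp \<zeta> * exp (\<i> * complex_of_real (2 * pi * y) * exp \<zeta>)" for \<zeta>
    define G where "G \<zeta> = L \<zeta> * exp (- w \<zeta>)" for \<zeta>
    have w: "w (Complex u v) = complex_of_real (\<tau> * exp (\<beta> * u)) * cis (\<beta> * v)" for u v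
    proof -
      have "complex_of_real \<beta> * Complex u v = Complex (\<beta> * u) (\<beta> * v)"
        by (simp add: complex_eq_iff)
      then show ?thesis
        by (simp add: w_def exp_Complex)
    qed
    have normL: "norm (L (Complex u v)) = exp u * exp (- (2 * pi * y * exp u * sin v))" for u v
      by (simp add: L_def exp_Complex norm_mult)
    have cosv: "1/2 \<le> cos (\<beta> * v)" if "0 \<le> v" "v \<le> \<phi>" for v
    proof -
      have "\<beta> * v \<le> \<beta> * \<phi>"
        using that assms by (intro mult_left_mono) auto
      then have v: "0 \<le> \<beta> * v" "\<beta> * v \<le> pi / 3"
        using that assms \<phi>(3) pi_gt_zero by (simp, linarith)
      have "cos (pi / 3) \<le> cos (\<beta> * v)"
        using v by (intro cos_monotone_0_pi_le) auto
      then show ?thesis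
        by (simp add: cos_60)
    qed
    have normG: "norm (G (Complex u v)) \<le> exp u * exp (- (\<tau> / 2) * exp u powr \<beta>)" if "0 \<le> v" "v \<le> \<phi>" for u v
    proof -
      have "sin v \<ge> 0"
        using that \<phi> by (intro sin_ge_zero) auto
      then have "norm (L (Complex u v)) \<le> exp u * 1"
        unfolding normL using y by (intro mult_left_mono) auto
      moreover have "norm (exp (- w (Complex u v))) \<le> exp (- (\<tau> / 2) * exp u powr \<beta>)"
        using cosv[OF that] \<tau> by (simp add: w exp_powr_real mult.commute)
      ultimately show ?thesis
        unfolding G_def norm_mult by (intro mult_mono) auto
    qed
    \<comment> \<open>Half of the rate \<sigma> absorbs exp u powr \<beta>, at the price
      \<sigma>^(-\<beta>); integrating what remains yields the further factor 2 / \<sigma>.\<close>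
    have bound: "norm (G (Complex u \<phi>) - L (Complex u \<phi>)) \<le> K * \<tau> * \<sigma> powr (- \<beta>) * (exp u * exp (- (\<sigma> / 2) * exp u))" for u
    proof -
      have "Re (w (Complex u \<phi>)) \<ge> 0"
        using cosv[of \<phi>] \<phi> \<tau> by (simp add: w)
      then have "norm (exp (- w (Complex u \<phi>)) - 1) \<le> norm (w (Complex u \<phi>))"
        using norm_exp_minus_one_le by simp
      also have "\<dots> = \<tau> * exp u powr \<beta>"
        using \<tau> by (simp add: w norm_mult exp_powr_real mult.commute)
      also have "exp u powr \<beta> = \<sigma> powr (- \<beta>) * (\<sigma> * exp u) powr \<beta>"
        using \<sigma> by (simp add: powr_mult powr_minus)
      also have "\<dots> \<le> \<sigma> powr (- \<beta>) * (K * exp (\<sigma> * exp u / 2))"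
        using \<sigma> by (intro mult_left_mono K) auto
      finally have "norm (L (Complex u \<phi>)) * norm (exp (- w (Complex u \<phi>)) - 1)
        \<le> norm (L (Complex u \<phi>)) * (\<tau> * (\<sigma> powr (- \<beta>) * (K * exp (\<sigma> * exp u / 2))))"
        using \<tau> by (intro mult_left_mono) auto
      also have "\<dots> = K * \<tau> * \<sigma> powr (- \<beta>) * (exp u * (exp (- (\<sigma> * exp u)) * exp (\<sigma> * exp u / 2)))"
      proof -
        have "norm (L (Complex u \<phi>)) = exp u * exp (- (\<sigma> * exp u))"
          unfolding normL \<sigma>_def by (simp add: mult_ac)
        then show ?thesis
          by (simp only: ac_simps)
      qed
      also have "exp (- (\<sigma> * exp u)) * exp (\<sigma> * exp u / 2) = exp (- (\<sigma> / 2) * exp u)"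
        by (simp flip: exp_add)
      finally have "norm (L (Complex u \<phi>) * (exp (- w (Complex u \<phi>)) - 1))
          \<le> K * \<tau> * \<sigma> powr (- \<beta>) * (exp u * exp (- (\<sigma> / 2) * exp u))"
        unfolding norm_mult .
      moreover have "G (Complex u \<phi>) - L (Complex u \<phi>) = L (Complex u \<phi>) * (exp (- w (Complex u \<phi>)) - 1)"
        by (simp add: G_def right_diff_distrib)
      ultimately show ?thesis
        by (simp only:)
    qed
    \<comment> \<open>An antiderivative of exp (2 pi i y z), evaluated at z = t cis \<phi>; it
      integrates \<open>L\<close> along the rotated line exactly.\<close>
    define P where "P t = exp (\<i> * complex_of_real (2 * pi * y) * (complex_of_real t * cis \<phi>)) / (\<i> * complex_of_real (2 * pi * y))" for t
    define I where "I n = (LINT x:{1 / real (Suc n)..real (Suc n)}|lborel. target \<tau> \<beta> x * cos (2 * pi * y * x))" for n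
    \<comment> \<open>The two vertical sides, each of length \<phi>: the left one has modulus at
      most 1/(n+1), and on the right one the stretched exponential outweighs the Jacobian.\<close>
    define e where "e n = \<phi> * (1 / real (Suc n) + real (Suc n) * exp (- (\<tau> / 2) * real (Suc n) powr \<beta>))" for n
    have main: "\<bar>I n\<bar> \<le> e n + \<bar>Re (P (real (Suc n)) - P (1 / real (Suc n)))\<bar> + 2 * K * \<tau> * \<sigma> powr (- 1 - \<beta>)" for n
    proof -
      define a where "a = 1 / real (Suc n)"
      define b where "b = real (Suc n)"
      have ab: "0 < a" "a \<le> b" "0 < b"
        by (auto simp: a_def b_def field_simps)
      define A where "A = ln a"
      define B where "B = ln b"
      have AB: "A \<le> B" "exp A = a" "exp B = b"
        using ab by (auto simp: A_def B_def)
      have "L holomorphic_on UNIV" "G holomorphic_on UNIV"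
        unfolding G_def L_def w_def by (intro holomorphic_intros)+
      note hol = this
      have curve: "((\<lambda>u. Complex u v) has_vector_derivative 1) (at u within S)" for u v S
        unfolding Complex_eq
        by (auto intro!: derivative_eq_intros simp: has_vector_derivative_def fun_eq_iff scaleR_conv_of_real)
      have int: "(\<lambda>u. F (Complex u v)) integrable_on {A..B}" if "F holomorphic_on UNIV" for F v
      proof (intro integrable_continuous_real continuous_on_compose2[OF holomorphic_on_imp_continuous_on[OF that]])
        show "continuous_on {A..B} (\<lambda>u. Complex u v)"
          by (rule continuous_on_vector_derivative) (rule curve)
      qed auto
      have I: "Re (integral {A..B} (\<lambda>u. G (Complex u 0))) = I n"
      proof -
        let ?f = "\<lambda>x. target \<tau> \<beta> x * cos (2 * pi * y * x)"
        have "((\<lambda>u. exp u *\<^sub>R ?f (exp u)) has_integral integral {exp A..exp B} ?f) {A..B}"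
          using AB assms
          by (intro has_integral_substitution[where c = a and d = b])
             (auto intro!: derivative_eq_intros continuous_intros continuous_at_imp_continuous_on isCont_target
               simp flip: AB(2,3))
        moreover have "Re (G (Complex u 0)) = exp u *\<^sub>R ?f (exp u)" for u
          using exp_minus[of "\<tau> * exp (\<beta> * u)"]
          by (simp add: G_def L_def w exp_Complex Re_exp Im_exp exp_powr_real target_def mult_ac)
        ultimately have "integral {A..B} (Re \<circ> (\<lambda>u. G (Complex u 0))) = integral {a..b} ?f"
          by (simp add: comp_def AB integral_unique)
        moreover have "integral {A..B} (Re \<circ> (\<lambda>u. G (Complex u 0))) = Re (integral {A..B} (\<lambda>u. G (Complex u 0)))"
          by (intro integral_linear int hol bounded_linear_Re)
        moreover have "set_integrable lborel {a..b} ?f"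
          unfolding set_integrable_def
          by (intro integrable_mult_indicator integrable_target_cos \<tau> assms) auto
        ultimately show ?thesis
          by (simp add: I_def set_borel_integral_eq_integral a_def b_def)
      qed
      have e: "e n = \<phi> * (a + b * exp (- (\<tau> / 2) * b powr \<beta>))"
        by (simp only: e_def a_def b_def)
      have shift: "norm (integral {A..B} (\<lambda>u. G (Complex u 0)) - integral {A..B} (\<lambda>u. G (Complex u \<phi>))) \<le> e n"
        unfolding e
      proof (rule horizontal_integral_shift[OF hol(2) AB(1)])
        show "norm (G (Complex A v)) \<le> a" if "0 \<le> v" "v \<le> \<phi>" for v
        proof -
          have "exp A * exp (- (\<tau> / 2) * exp A powr \<beta>) \<le> a * 1"
            using \<tau> ab unfolding AB by (intro mult_left_mono) auto
          with normG[OF that, of A] show ?thesis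
            by simp
        qed
        show "norm (G (Complex B v)) \<le> b * exp (- (\<tau> / 2) * b powr \<beta>)" if "0 \<le> v" "v \<le> \<phi>" for v
          using normG[OF that, of B] by (simp add: AB)
      qed (use \<phi> in auto)
      have diff: "norm (integral {A..B} (\<lambda>u. G (Complex u \<phi>)) - integral {A..B} (\<lambda>u. L (Complex u \<phi>)))
          \<le> 2 * K * \<tau> * \<sigma> powr (- 1 - \<beta>)"
      proof -
        have "((\<lambda>u. exp u * exp (- (\<sigma> / 2) * exp u)) has_integral
            (- (2 / \<sigma>) * exp (- (\<sigma> / 2) * exp B)) - (- (2 / \<sigma>) * exp (- (\<sigma> / 2) * exp A))) {A..B}"
          using \<sigma> by (intro fundamental_theorem_of_calculus AB)
            (auto intro!: derivative_eq_intros simp flip: has_real_derivative_iff_has_vector_derivative)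
        then have hi: "((\<lambda>u. K * \<tau> * \<sigma> powr (- \<beta>) * (exp u * exp (- (\<sigma> / 2) * exp u))) has_integral
            K * \<tau> * \<sigma> powr (- \<beta>) * ((- (2 / \<sigma>) * exp (- (\<sigma> / 2) * exp B)) - (- (2 / \<sigma>) * exp (- (\<sigma> / 2) * exp A)))) {A..B}"
          by (rule has_integral_mult_right)
        have "norm (integral {A..B} (\<lambda>u. G (Complex u \<phi>) - L (Complex u \<phi>)))
           \<le> integral {A..B} (\<lambda>u. K * \<tau> * \<sigma> powr (- \<beta>) * (exp u * exp (- (\<sigma> / 2) * exp u)))"
          using bound by (intro integral_norm_bound_integral integrable_diff int hol has_integral_integrable[OF hi])
        also have "\<dots> = K * \<tau> * \<sigma> powr (- \<beta>) * ((- (2 / \<sigma>) * exp (- (\<sigma> / 2) * exp B)) - (- (2 / \<sigma>) * exp (- (\<sigma> / 2) * exp A)))"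
          using hi by (rule integral_unique)
        also have "\<dots> \<le> K * \<tau> * \<sigma> powr (- \<beta>) * (2 / \<sigma>)"
        proof (intro mult_left_mono)
          have "(2 / \<sigma>) * exp (- (\<sigma> / 2) * exp A) \<le> (2 / \<sigma>) * 1"
            using \<sigma> by (intro mult_left_mono) auto
          moreover have "0 \<le> (2 / \<sigma>) * exp (- (\<sigma> / 2) * exp B)"
            using \<sigma> by simp
          ultimately show "(- (2 / \<sigma>) * exp (- (\<sigma> / 2) * exp B)) - (- (2 / \<sigma>) * exp (- (\<sigma> / 2) * exp A)) \<le> 2 / \<sigma>"
            by linarith
        qed (use K \<tau> in auto)
        also have "\<dots> = 2 * K * \<tau> * \<sigma> powr (- 1 - \<beta>)"
        proof -
          have "\<sigma> powr (- 1 - \<beta>) = \<sigma> powr (- \<beta>) / \<sigma>"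
            using powr_diff[of \<sigma> "- \<beta>" 1] \<sigma> by (simp add: minus_diff_commute)
          then show ?thesis
            by simp
        qed
        finally show ?thesis
          by (simp add: Henstock_Kurzweil_Integration.integral_diff int hol)
      qed
      have L: "integral {A..B} (\<lambda>u. L (Complex u \<phi>)) = P b - P a"
      proof -
        define \<Phi> where "\<Phi> \<zeta> = exp (\<i> * complex_of_real (2 * pi * y) * exp \<zeta>) / (\<i> * complex_of_real (2 * pi * y))" for \<zeta>
        have "(\<Phi> has_field_derivative L \<zeta>) (at \<zeta> within S)" for \<zeta> S
          unfolding \<Phi>_def L_def using y by (auto intro!: derivative_eq_intros)
        then have "((\<lambda>u. \<Phi> (Complex u \<phi>)) has_vector_derivative L (Complex u \<phi>)) (at u within {A..B})" for u
          using field_vector_diff_chain_within[OF curve[of \<phi> u "{A..B}"], of \<Phi> "L (Complex u \<phi>)"] by (simp add: comp_def)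
        then have "((\<lambda>u. L (Complex u \<phi>)) has_integral \<Phi> (Complex B \<phi>) - \<Phi> (Complex A \<phi>)) {A..B}"
          by (intro fundamental_theorem_of_calculus AB)
        moreover have "\<Phi> (Complex B \<phi>) = P b" "\<Phi> (Complex A \<phi>) = P a"
          by (simp_all add: \<Phi>_def P_def exp_Complex AB)
        ultimately show ?thesis
          by (simp add: integral_unique)
      qed
      have "\<bar>Re (integral {A..B} (\<lambda>u. G (Complex u 0)) - integral {A..B} (\<lambda>u. G (Complex u \<phi>)))\<bar> \<le> e n"
        "\<bar>Re (integral {A..B} (\<lambda>u. G (Complex u \<phi>)) - integral {A..B} (\<lambda>u. L (Complex u \<phi>)))\<bar>
          \<le> 2 * K * \<tau> * \<sigma> powr (- 1 - \<beta>)"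
        using shift diff abs_Re_le_cmod order.trans by blast+
      then show ?thesis
        using I unfolding L a_def b_def by simp
    qed
    have "e \<longlonglongrightarrow> \<phi> * (0 + 0)"
      unfolding e_def
    proof (intro tendsto_intros)
      show "(\<lambda>n. 1 / real (Suc n)) \<longlonglongrightarrow> 0"
        by (rule lim_1_over_n[THEN LIMSEQ_Suc])
      have "((\<lambda>x. x * exp (- (\<tau> / 2) * x powr \<beta>)) \<longlongrightarrow> 0) at_top"
        using \<tau> assms by real_asymp
      moreover have "filterlim (\<lambda>n. real (Suc n)) at_top sequentially"
        by (rule filterlim_real_sequentially[THEN filterlim_compose, OF filterlim_Suc])
      ultimately show "(\<lambda>n. real (Suc n) * exp (- (\<tau> / 2) * real (Suc n) powr \<beta>)) \<longlonglongrightarrow> 0"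
        by (rule filterlim_compose)
    qed
    moreover have "(\<lambda>n. P (real (Suc n))) \<longlonglongrightarrow> 0"
    proof (rule tendsto_norm_zero_cancel)
      have "norm (P t) = exp (- \<sigma> * t) / (2 * pi * y)" for t
        using y by (simp add: P_def norm_divide norm_mult \<sigma>_def mult_ac)
      moreover have "((\<lambda>t. exp (- \<sigma> * t) / (2 * pi * y)) \<longlongrightarrow> 0) at_top"
        using \<sigma> y by real_asymp
      moreover have "filterlim (\<lambda>n. real (Suc n)) at_top sequentially"
        by (rule filterlim_real_sequentially[THEN filterlim_compose, OF filterlim_Suc])
      ultimately show "(\<lambda>n. norm (P (real (Suc n)))) \<longlonglongrightarrow> 0"
        by (simp only:) (rule filterlim_compose)
    qed
    moreover have "(\<lambda>n. P (1 / real (Suc n))) \<longlonglongrightarrow> P 0"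
    proof -
      have "isCont P 0"
        unfolding P_def using y by (intro continuous_intros) auto
      then show ?thesis
        by (rule isCont_tendsto_compose) (rule lim_1_over_n[THEN LIMSEQ_Suc])
    qed
    ultimately have lim1: "(\<lambda>n. 2 * (e n + \<bar>Re (P (real (Suc n)) - P (1 / real (Suc n)))\<bar> + 2 * K * \<tau> * \<sigma> powr (- 1 - \<beta>)))
      \<longlonglongrightarrow> 2 * (\<phi> * (0 + 0) + \<bar>Re (0 - P 0)\<bar> + 2 * K * \<tau> * \<sigma> powr (- 1 - \<beta>))"
      by (intro tendsto_intros)
    have lim2: "(\<lambda>n. \<bar>2 * I n\<bar>) \<longlonglongrightarrow> \<bar>target_ft \<tau> \<beta> y\<bar>"
      unfolding I_def target_ft_eq_cos[OF \<tau> assms]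
      by (intro tendsto_rabs lborel_integral_even_limit integrable_target_cos \<tau> assms) (simp add: target_minus)
    have le: "\<bar>2 * I n\<bar> \<le> 2 * (e n + \<bar>Re (P (real (Suc n)) - P (1 / real (Suc n)))\<bar> + 2 * K * \<tau> * \<sigma> powr (- 1 - \<beta>))" for n
      using main[of n] unfolding abs_mult by simp
    have "\<bar>target_ft \<tau> \<beta> y\<bar> \<le> 2 * (\<phi> * (0 + 0) + \<bar>Re (0 - P 0)\<bar> + 2 * K * \<tau> * \<sigma> powr (- 1 - \<beta>))"
      by (rule LIMSEQ_le[OF lim2 lim1]) (use le in blast)
    \<comment> \<open>P 0 = 1 / (2 pi i y) is purely imaginary. This removes the contribution of
      order 1/y and leaves the order y^(-1-\<beta>).\<close>
    moreover have "Re (P 0) = 0"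
      by (simp add: P_def Re_divide)
    ultimately show ?thesis
      by (simp add: \<sigma>_def)
  qed
  have "\<bar>target_ft \<tau> \<beta> y\<bar> \<le> (4 * K * (2 * pi * sin \<phi>) powr (- 1 - \<beta>)) * \<tau> * y powr (- 1 - \<beta>)"
    if "\<tau> > 0" "y > 0" for \<tau> y
  proof -
    have "(2 * pi * y * sin \<phi>) powr (- 1 - \<beta>) = (2 * pi * sin \<phi>) powr (- 1 - \<beta>) * y powr (- 1 - \<beta>)"
      using that sin\<phi> by (subst powr_mult[symmetric]) (auto simp: mult_ac)
    with bd[OF that] show ?thesis
      by (simp only: ac_simps)
  qed
  then show ?thesis
    using K sin\<phi> by (intro exI[of _ "4 * K * (2 * pi * sin \<phi>) powr (- 1 - \<beta>)"]) auto
qed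

section \<open>Exponential decay for even integer exponents\<close>

text \<open>If v is small against |x|, then (1 + i v/x)^n is close to 1 and x^n >= 0 by parity;
  otherwise |x| <= v/d and every term is of order v^n. The constant C covers the sum of |x + i v|^n
  and x^n / 2 in the second case.\<close>

lemma Re_power_ge:
  assumes "even n"
  obtains C where "C > 0" "\<And>x v. v \<ge> 0 \<Longrightarrow> Re (Complex x v ^ n) \<ge> x ^ n / 2 - C * v ^ n"
proof -
  have "((\<lambda>w::complex. Re ((1 + w) ^ n)) \<longlongrightarrow> Re ((1 + 0) ^ n)) (at 0)"
    by (intro tendsto_intros)
  then have "eventually (\<lambda>w::complex. Re ((1 + w) ^ n) > 1/2) (at 0)"
    by (rule order_tendstoD) simp
  then obtain d where d: "d > 0" "\<And>w::complex. w \<noteq> 0 \<Longrightarrow> norm w < d \<Longrightarrow> Re ((1 + w) ^ n) > 1/2"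
    by (auto simp: eventually_at)
  define C where "C = 2 * (1 / d + 1) ^ n"
  have "x ^ n / 2 - C * v ^ n \<le> Re (Complex x v ^ n)" if v: "v \<ge> 0" for x v
  proof (cases "v < d * \<bar>x\<bar>")
    case True
    then have x: "x \<noteq> 0"
      using v by auto
    have "norm (Complex 0 (v / x)) = v / \<bar>x\<bar>"
      using v by (simp add: cmod_eq_Im)
    also have "\<dots> < d"
      using True x by (simp add: field_simps)
    finally have "norm (Complex 0 (v / x)) < d" .
    then have "Re ((1 + Complex 0 (v / x)) ^ n) \<ge> 1/2"
      using d(2)[of "Complex 0 (v / x)"] d(1) by (cases "Complex 0 (v / x) = 0") auto
    moreover have "Complex x v = complex_of_real x * (1 + Complex 0 (v / x))"
      using x by (simp add: complex_eq_iff)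
    then have "Re (Complex x v ^ n) = x ^ n * Re ((1 + Complex 0 (v / x)) ^ n)"
      by (simp add: power_mult_distrib flip: of_real_power)
    moreover have "x ^ n \<ge> 0"
      using assms by (rule zero_le_even_power)
    ultimately have "x ^ n * (1/2) \<le> Re (Complex x v ^ n)"
      by (simp only: mult_left_mono)
    moreover have "0 \<le> C * v ^ n"
      using d v by (simp add: C_def)
    ultimately show ?thesis
      by simp
  next
    case False
    then have x: "\<bar>x\<bar> \<le> v / d"
      using d by (simp add: field_simps)
    have "norm (Complex x v) \<le> (1 / d + 1) * v"
      using x v cmod_le[of "Complex x v"] by (simp add: algebra_simps)
    then have "norm (Complex x v) ^ n \<le> ((1 / d + 1) * v) ^ n"
      by (intro power_mono) auto
    then have "- ((1 / d + 1) ^ n * v ^ n) \<le> Re (Complex x v ^ n)"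
      using abs_Re_le_cmod[of "Complex x v ^ n"] by (simp add: norm_power power_mult_distrib)
    moreover have "x ^ n \<le> ((1 / d + 1) * v) ^ n"
    proof -
      have "\<bar>x\<bar> ^ n \<le> ((1 / d + 1) * v) ^ n"
        using x v by (intro power_mono) (auto simp: algebra_simps)
      then show ?thesis
        using assms by (simp add: power_even_abs)
    qed
    moreover have "0 \<le> ((1 / d + 1) * v) ^ n"
      using d v by simp
    ultimately show ?thesis
      unfolding C_def power_mult_distrib by linarith
  qed
  moreover have "C > 0"
    using d by (simp add: C_def add_pos_pos)
  ultimately show ?thesis
    by (intro that[of C])
qed

text \<open>Since u^n >= u^2 - 1, all even powers share one majorant, chosen because its integral is
  an arctangent; the constant does not depend on n.\<close>

lemma exp_minus_even_power_le:
  fixes u :: real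
  assumes "even n" "n > 0"
  shows "exp (- (u ^ n) / 2) \<le> 2 * exp (1/2) * inverse (1 + u\<^sup>2)"
proof -
  have "u\<^sup>2 - 1 \<le> u ^ n"
  proof (cases "\<bar>u\<bar> \<le> 1")
    case True
    then have "u\<^sup>2 \<le> 1"
      by (simp add: abs_square_le_1)
    moreover have "0 \<le> u ^ n"
      using assms(1) by (rule zero_le_even_power)
    ultimately show ?thesis
      by simp
  next
    case False
    have "2 \<le> n"
      using assms by (auto elim: evenE)
    then have "\<bar>u\<bar> ^ 2 \<le> \<bar>u\<bar> ^ n"
      using False by (intro power_increasing) auto
    then show ?thesis
      using assms by (simp add: power_even_abs)
  qed
  then have "exp (- (u ^ n) / 2) \<le> exp (1/2 + - (u\<^sup>2 / 2))"
    by simp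
  also have "\<dots> = exp (1/2) * inverse (exp (u\<^sup>2 / 2))"
    by (simp only: exp_add exp_minus)
  also have "\<dots> \<le> exp (1/2) * inverse ((1 + u\<^sup>2) / 2)"
  proof (intro mult_left_mono le_imp_inverse_le)
    show "(1 + u\<^sup>2) / 2 \<le> exp (u\<^sup>2 / 2)"
      by (rule order.trans[OF _ exp_ge_add_one_self]) (simp add: add_divide_distrib)
  qed (auto simp: add_pos_nonneg)
  finally show ?thesis
    by (simp only: inverse_divide) (simp only: divide_inverse ac_simps)
qed

text \<open>For an even integer exponent the integrand continues to an entire function, so nothing
  has to be cut out around 0.\<close>

lemma lborel_integral_symmetric_limit:
  fixes h :: "real \<Rightarrow> real"
  assumes h: "integrable lborel h"
  shows "(\<lambda>m. LINT x:{- real (Suc m)..real (Suc m)}|lborel. h x) \<longlonglongrightarrow> (LINT x|lborel. h x)"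
  unfolding set_lebesgue_integral_def
proof (rule integral_dominated_convergence[where w = "\<lambda>x. \<bar>h x\<bar>"])
  note [measurable] = borel_measurable_integrable[OF h]
  show "AE x in lborel. (\<lambda>m. indicat_real {- real (Suc m)..real (Suc m)} x *\<^sub>R h x) \<longlonglongrightarrow> h x"
  proof (intro always_eventually allI)
    fix x
    obtain N where N: "real N > \<bar>x\<bar>"
      using reals_Archimedean2 by blast
    have "indicat_real {- real (Suc m)..real (Suc m)} x *\<^sub>R h x = h x" if "m \<ge> N" for m
    proof -
      have "\<bar>x\<bar> \<le> real (Suc m)"
        using N that by linarith
      then show ?thesis
        by (auto simp: indicator_def abs_le_iff)
    qed
    then show "(\<lambda>m. indicat_real {- real (Suc m)..real (Suc m)} x *\<^sub>R h x) \<longlonglongrightarrow> h x"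
      by (intro tendsto_eventually) (auto simp: eventually_sequentially)
  qed
qed (use h in \<open>auto simp: indicator_def borel_measurable_integrable\<close>)

text \<open>Shifting the line of integration up by \<open>s\<close> gains \<open>exp (- 2 \<pi> y s)\<close> and costs \<open>exp (C \<tau> s^n)\<close>.\<close>

lemma target_ft_decay_even:
  assumes n: "even n" "n > 0"
  shows "\<exists>C>0. \<exists>K>0. \<forall>\<tau>>0. \<forall>y\<ge>0. \<forall>s\<ge>0.
    \<bar>target_ft \<tau> (real n) y\<bar> \<le> K * \<tau> powr (- 1 / real n) * exp (C * \<tau> * s ^ n - 2 * pi * y * s)"
proof (rule Re_power_ge[OF n(1)])
  fix C assume C: "C > 0" "\<And>x v. v \<ge> 0 \<Longrightarrow> Re (Complex x v ^ n) \<ge> x ^ n / 2 - C * v ^ n"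
  define K where "K = 2 * exp (1/2 :: real) * pi"
  have "\<bar>target_ft \<tau> (real n) y\<bar> \<le> K * \<tau> powr (- 1 / real n) * exp (C * \<tau> * s ^ n - 2 * pi * y * s)"
    if \<tau>: "\<tau> > 0" and y: "y \<ge> 0" and s: "s \<ge> 0" for \<tau> y s
  proof -
    \<comment> \<open>The natural length scale: \<tau> x^n = (\<kappa> x)^n. Integrating the
      majorant in \<kappa> x produces pi / \<kappa> = pi \<tau>^(-1/n).\<close>
    define \<kappa> where "\<kappa> = \<tau> powr (1 / real n)"
    have \<kappa>0: "\<kappa> > 0"
      using \<tau> by (simp add: \<kappa>_def)
    have "\<kappa> ^ n = \<kappa> powr real n"
      using \<kappa>0 by (rule powr_realpow[symmetric])
    also have "\<dots> = \<tau>"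
      using \<tau> n by (simp add: \<kappa>_def powr_powr)
    finally have \<kappa>: "\<kappa> > 0" "\<kappa> ^ n = \<tau>"
      using \<kappa>0 by auto
    define E where "E = exp (C * \<tau> * s ^ n - 2 * pi * y * s)"
    define G where "G \<zeta> = exp (\<i> * complex_of_real (2 * pi * y) * \<zeta> - complex_of_real \<tau> * \<zeta> ^ n)" for \<zeta>
    have hol: "G holomorphic_on UNIV"
      unfolding G_def by (intro holomorphic_intros)
    \<comment> \<open>Parity removes the absolute value; x = 0 is separate because powr agrees with
      the integer power only for a positive base, and there both sides are 1.\<close>
    have target: "target \<tau> (real n) x = exp (- (\<tau> * x ^ n))" for x
      using n by (cases "x = 0") (auto simp: target_def powr_realpow power_even_abs)
    have normG: "norm (G (Complex x v)) \<le> exp (- (\<tau> * x ^ n) / 2 + C * \<tau> * v ^ n - 2 * pi * y * v)" if "v \<ge> 0" for x v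
    proof -
      have "\<tau> * (x ^ n / 2 - C * v ^ n) \<le> \<tau> * Re (Complex x v ^ n)"
        using C(2)[OF that] \<tau> by (intro mult_left_mono) auto
      then show ?thesis
        by (simp add: G_def algebra_simps)
    qed
    define R where "R m = real (Suc m)" for m
    define I where "I m = (LINT x:{- R m..R m}|lborel. target \<tau> (real n) x * cos (2 * pi * y * x))" for m
    define e where "e m = s * (2 * exp (C * \<tau> * s ^ n - (\<tau> / 2) * R m))" for m
    have le: "\<bar>I m\<bar> \<le> e m + K * \<tau> powr (- 1 / real n) * E" for m
    proof -
      have R: "R m \<ge> 1"
        by (simp add: R_def)
      have cont: "(\<lambda>x. G (Complex x v)) integrable_on {- R m..R m}" for v
        unfolding G_def Complex_eq by (intro integrable_continuous_real continuous_intros)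
      have Re: "Re (integral {- R m..R m} (\<lambda>x. G (Complex x 0))) = I m"
      proof -
        have "Re (G (Complex x 0)) = target \<tau> (real n) x * cos (2 * pi * y * x)" for x
        proof -
          have "\<i> * complex_of_real (2 * pi * y) * Complex x 0 - complex_of_real \<tau> * Complex x 0 ^ n
              = Complex (- (\<tau> * x ^ n)) (2 * pi * y * x)"
            unfolding Complex_eq by simp
          then have "G (Complex x 0) = exp (Complex (- (\<tau> * x ^ n)) (2 * pi * y * x))"
            by (simp only: G_def)
          then show ?thesis
            by (simp add: exp_Complex target)
        qed
        moreover have "integral {- R m..R m} (Re \<circ> (\<lambda>x. G (Complex x 0))) = Re (integral {- R m..R m} (\<lambda>x. G (Complex x 0)))"
          by (intro integral_linear cont bounded_linear_Re)
        moreover have "set_integrable lborel {- R m..R m} (\<lambda>x. target \<tau> (real n) x * cos (2 * pi * y * x))"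
          unfolding set_integrable_def
          using n by (intro integrable_mult_indicator integrable_target_cos \<tau>) auto
        ultimately show ?thesis
          by (simp add: I_def set_borel_integral_eq_integral comp_def)
      qed
      \<comment> \<open>R >= 1 gives R <= R^n, so a bound linear in R in the exponent suffices to
        make the sides vanish.\<close>
      have side: "norm (G (Complex x v)) \<le> exp (C * \<tau> * s ^ n - (\<tau> / 2) * R m)" if "0 \<le> v" "v \<le> s" "\<bar>x\<bar> = R m" for x v
      proof -
        have "R m \<le> \<bar>x\<bar> ^ n"
          using R n that power_increasing[of 1 n "R m"] by simp
        then have "\<tau> * R m \<le> \<tau> * x ^ n"
          using \<tau> n by (intro mult_left_mono) (auto simp: power_even_abs)
        moreover have "C * \<tau> * v ^ n \<le> C * \<tau> * s ^ n"
          using that C \<tau> by (intro mult_left_mono power_mono) auto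
        moreover have "0 \<le> 2 * pi * y * v"
          using that y by simp
        ultimately have "exp (- (\<tau> * x ^ n) / 2 + C * \<tau> * v ^ n - 2 * pi * y * v) \<le> exp (C * \<tau> * s ^ n - (\<tau> / 2) * R m)"
          unfolding exp_le_cancel_iff by argo
        then show ?thesis
          by (rule order.trans[OF normG[OF that(1)]])
      qed
      have "norm (integral {- R m..R m} (\<lambda>x. G (Complex x 0)) - integral {- R m..R m} (\<lambda>x. G (Complex x s)))
          \<le> s * (exp (C * \<tau> * s ^ n - (\<tau> / 2) * R m) + exp (C * \<tau> * s ^ n - (\<tau> / 2) * R m))"
        using R s side by (intro horizontal_integral_shift hol) auto
      then have shift: "norm (integral {- R m..R m} (\<lambda>x. G (Complex x 0)) - integral {- R m..R m} (\<lambda>x. G (Complex x s))) \<le> e m"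
        by (simp add: e_def)
      have top: "norm (integral {- R m..R m} (\<lambda>x. G (Complex x s))) \<le> K * \<tau> powr (- 1 / real n) * E"
      proof -
        have arctan: "((\<lambda>x. 1 / (1 + (\<kappa> * x)\<^sup>2)) has_integral arctan (\<kappa> * R m) / \<kappa> - arctan (\<kappa> * - R m) / \<kappa>) {- R m..R m}"
          using \<kappa> R by (intro fundamental_theorem_of_calculus)
            (auto intro!: derivative_eq_intros simp: divide_simps simp flip: has_real_derivative_iff_has_vector_derivative)
        have hi: "((\<lambda>x. 2 * exp (1/2) * E * (1 / (1 + (\<kappa> * x)\<^sup>2))) has_integral
            2 * exp (1/2) * E * (arctan (\<kappa> * R m) / \<kappa> - arctan (\<kappa> * - R m) / \<kappa>)) {- R m..R m}"
          using arctan by (rule has_integral_mult_right)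
        have "norm (integral {- R m..R m} (\<lambda>x. G (Complex x s)))
            \<le> integral {- R m..R m} (\<lambda>x. 2 * exp (1/2) * E * (1 / (1 + (\<kappa> * x)\<^sup>2)))"
        proof (rule integral_norm_bound_integral)
          fix x
          have "- (\<tau> * x ^ n) / 2 + C * \<tau> * s ^ n - 2 * pi * y * s = (C * \<tau> * s ^ n - 2 * pi * y * s) + - ((\<kappa> * x) ^ n) / 2"
            by (simp add: power_mult_distrib \<kappa>)
          then have "norm (G (Complex x s)) \<le> E * exp (- ((\<kappa> * x) ^ n) / 2)"
            using normG[OF s, of x] by (simp only: E_def exp_add)
          also have "\<dots> \<le> E * (2 * exp (1/2) * inverse (1 + (\<kappa> * x)\<^sup>2))"
            by (intro mult_left_mono exp_minus_even_power_le n) (simp add: E_def)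
          finally show "norm (G (Complex x s)) \<le> 2 * exp (1/2) * E * (1 / (1 + (\<kappa> * x)\<^sup>2))"
            by (simp only: divide_inverse ac_simps mult_1_left)
        qed (use cont hi in auto)
        also have "\<dots> = 2 * exp (1/2) * E * (arctan (\<kappa> * R m) / \<kappa> - arctan (\<kappa> * - R m) / \<kappa>)"
          using hi by (rule integral_unique)
        also have "\<dots> \<le> 2 * exp (1/2) * E * (pi / \<kappa>)"
        proof (intro mult_left_mono)
          have "(arctan (\<kappa> * R m) - arctan (\<kappa> * - R m)) / \<kappa> \<le> pi / \<kappa>"
            using arctan_ubound[of "\<kappa> * R m"] \<kappa> by (intro divide_right_mono) (auto simp: arctan_minus)
          then show "arctan (\<kappa> * R m) / \<kappa> - arctan (\<kappa> * - R m) / \<kappa> \<le> pi / \<kappa>"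
            by (simp add: diff_divide_distrib)
        qed (simp add: E_def)
        finally have *: "norm (integral {- R m..R m} (\<lambda>x. G (Complex x s))) \<le> 2 * exp (1/2) * E * (pi / \<kappa>)" .
        have "\<tau> powr (- 1 / real n) = inverse \<kappa>"
          using powr_minus[of \<tau> "1 / real n"] by (simp only: \<kappa>_def minus_divide_left)
        with * show ?thesis
          by (simp only: K_def divide_inverse ac_simps)
      qed
      have "\<bar>Re (integral {- R m..R m} (\<lambda>x. G (Complex x 0)))\<bar> \<le> norm (integral {- R m..R m} (\<lambda>x. G (Complex x 0)))"
        by (rule abs_Re_le_cmod)
      also have "\<dots> \<le> e m + K * \<tau> powr (- 1 / real n) * E"
        by (rule order.trans[OF norm_triangle_sub add_mono[OF top shift, unfolded add.commute[of _ "e m"]]])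
      finally show ?thesis
        by (simp only: Re)
    qed
    have lim1: "(\<lambda>m. e m + K * \<tau> powr (- 1 / real n) * E) \<longlonglongrightarrow> 0 + K * \<tau> powr (- 1 / real n) * E"
    proof (intro tendsto_intros)
      have "((\<lambda>x. s * (2 * exp (C * \<tau> * s ^ n - (\<tau> / 2) * x))) \<longlongrightarrow> 0) at_top"
        using \<tau> by real_asymp
      moreover have "filterlim R at_top sequentially"
        unfolding R_def[abs_def] by (rule filterlim_real_sequentially[THEN filterlim_compose, OF filterlim_Suc])
      ultimately show "e \<longlonglongrightarrow> 0"
        unfolding e_def[abs_def] by (rule filterlim_compose)
    qed
    have lim2: "(\<lambda>m. \<bar>I m\<bar>) \<longlonglongrightarrow> \<bar>target_ft \<tau> (real n) y\<bar>"
    proof -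
      have "real n > 0"
        using n by simp
      then show ?thesis
        unfolding I_def R_def target_ft_eq_cos[OF \<tau> \<open>real n > 0\<close>]
        by (intro tendsto_rabs lborel_integral_symmetric_limit integrable_target_cos \<tau>)
    qed
    have "\<bar>target_ft \<tau> (real n) y\<bar> \<le> 0 + K * \<tau> powr (- 1 / real n) * E"
      by (rule LIMSEQ_le[OF lim2 lim1]) (use le in blast)
    then show ?thesis
      by (simp add: E_def)
  qed
  moreover have "K > 0"
    by (simp add: K_def)
  ultimately show ?thesis
    using C(1) by (intro exI[of _ C] exI[of _ K]) auto
qed

section \<open>Approximation by compiled polynomials\<close>

text \<open>The grid is fixed before x is, so one threshold must serve all of K. Uniform continuity
  on the compact product provides it: each cell of width h contributes at most h \<delta> /
  Y.\<close>

lemma riemann_sum_uniform: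
  fixes \<phi> :: "real \<Rightarrow> 'a::metric_space \<Rightarrow> real"
  assumes Y: "Y > 0" and K: "compact K"
    and cont: "continuous_on ({0..Y} \<times> K) (\<lambda>(y, x). \<phi> y x)" and \<delta>: "\<delta> > 0"
  shows "\<exists>N0. \<forall>N\<ge>N0. N > 0 \<longrightarrow> (\<forall>x\<in>K.
    \<bar>(Y / real N) * (\<Sum>k=1..N. \<phi> (real k * (Y / real N)) x) - integral {0..Y} (\<lambda>y. \<phi> y x)\<bar> \<le> \<delta>)"
proof -
  have "uniformly_continuous_on ({0..Y} \<times> K) (\<lambda>(y, x). \<phi> y x)"
    using cont K by (intro compact_uniformly_continuous compact_Times) auto
  then obtain d where d: "d > 0" "\<And>p q. p \<in> {0..Y} \<times> K \<Longrightarrow> q \<in> {0..Y} \<times> K \<Longrightarrow> dist q p < d \<Longrightarrow>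
      dist (case q of (y, x) \<Rightarrow> \<phi> y x) (case p of (y, x) \<Rightarrow> \<phi> y x) < \<delta> / Y"
    unfolding uniformly_continuous_on_def using \<delta> Y by (metis divide_pos_pos)
  obtain N0 where N0: "real N0 > Y / d"
    using reals_Archimedean2 by blast
  have "\<bar>(Y / real N) * (\<Sum>k=1..N. \<phi> (real k * (Y / real N)) x) - integral {0..Y} (\<lambda>y. \<phi> y x)\<bar> \<le> \<delta>"
    if N: "N \<ge> N0" "N > 0" and x: "x \<in> K" for N x
  proof -
    define h where "h = Y / real N"
    have h: "h > 0" "real N * h = Y"
      using Y N by (auto simp: h_def)
    have "Y / d < real N"
      using N0 N by linarith
    then have hd: "h < d"
      using d(1) N Y by (simp add: h_def field_simps)
    have cx: "continuous_on {0..Y} (\<lambda>y. \<phi> y x)"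
    proof -
      have "continuous_on {0..Y} (\<lambda>y. case (y, x) of (y, x) \<Rightarrow> \<phi> y x)"
        by (rule continuous_on_compose2[OF cont]) (use x in \<open>auto intro!: continuous_intros\<close>)
      then show ?thesis
        by simp
    qed
    \<comment> \<open>Induction on the number of cells, with the error budget proportional to the
      length covered so far.\<close>
    have "\<bar>h * (\<Sum>k=1..m. \<phi> (real k * h) x) - integral {0..real m * h} (\<lambda>y. \<phi> y x)\<bar> \<le> real m * h * (\<delta> / Y)"
      if "m \<le> N" for m
      using that
    proof (induction m)
      case (Suc m)
      define p where "p = real m * h"
      define q where "q = real (Suc m) * h"
      have qY: "q \<le> Y"
        unfolding q_def h(2)[symmetric] using Suc.prems h by (intro mult_right_mono) auto
      have pq: "0 \<le> p" "p \<le> q" "q - p = h"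
        using h by (auto simp: p_def q_def algebra_simps)
      have cpq: "continuous_on {0..q} (\<lambda>y. \<phi> y x)" "continuous_on {p..q} (\<lambda>y. \<phi> y x)"
        using pq qY by (auto intro: continuous_on_subset[OF cx])
      have "integral {0..p} (\<lambda>y. \<phi> y x) + integral {p..q} (\<lambda>y. \<phi> y x) = integral {0..q} (\<lambda>y. \<phi> y x)"
        using pq cpq by (intro Henstock_Kurzweil_Integration.integral_combine integrable_continuous_real) auto
      moreover have "h * \<phi> q x - integral {p..q} (\<lambda>y. \<phi> y x) = integral {p..q} (\<lambda>y. \<phi> q x - \<phi> y x)"
        using pq cpq by (subst Henstock_Kurzweil_Integration.integral_diff) (auto intro!: integrable_continuous_real)
      moreover have "norm (integral {p..q} (\<lambda>y. \<phi> q x - \<phi> y x)) \<le> \<delta> / Y * (q - p)"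
      proof (rule integral_bound)
        fix y assume y: "y \<in> {p..q}"
        have "dist (q, x) (y, x) \<le> h"
          using y pq by (simp add: dist_Pair_Pair dist_real_def)
        then have "dist (case (q, x) of (y, x) \<Rightarrow> \<phi> y x) (case (y, x) of (y, x) \<Rightarrow> \<phi> y x) < \<delta> / Y"
          using y x pq qY hd by (intro d(2)) auto
        then show "norm (\<phi> q x - \<phi> y x) \<le> \<delta> / Y"
          by (simp add: dist_real_def)
      qed (use pq cpq in \<open>auto intro!: continuous_intros\<close>)
      moreover have "\<bar>h * (\<Sum>k=1..m. \<phi> (real k * h) x) - integral {0..p} (\<lambda>y. \<phi> y x)\<bar> \<le> real m * h * (\<delta> / Y)"
        using Suc by (simp add: p_def)
      moreover have "h * (\<Sum>k=1..Suc m. \<phi> (real k * h) x) = h * (\<Sum>k=1..m. \<phi> (real k * h) x) + h * \<phi> q x"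
        by (simp add: q_def distrib_left)
      moreover have "real (Suc m) * h * (\<delta> / Y) = real m * h * (\<delta> / Y) + \<delta> / Y * (q - p)"
        unfolding pq of_nat_Suc
        by (simp only: distrib_right mult_1_left mult.commute[of "\<delta> / Y" h] add.commute)
      ultimately show ?case
        unfolding q_def[symmetric] real_norm_def by linarith
    qed auto
    from this[of N] show ?thesis
      using Y unfolding h by (simp add: h_def)
  qed
  then show ?thesis
    by blast
qed

text \<open>The fundamental theorem on a half line for a majorant \<open>u\<close> with
  antiderivative \<open>U\<close>; both the power-law and the exponential tails are
  instances.\<close>

lemma set_integral_tail_le:
  fixes f u U :: "real \<Rightarrow> real"
  assumes f: "f \<in> borel_measurable borel" and u: "u \<in> borel_measurable borel"
    and U: "\<And>y. y \<ge> Y \<Longrightarrow> (U has_real_derivative u y) (at y)" "(U \<longlongrightarrow> 0) at_top"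
    and le: "\<And>y. y \<ge> Y \<Longrightarrow> \<bar>f y\<bar> \<le> u y"
  shows "set_integrable lborel {Y..} f" "(LINT y:{Y<..}|lborel. \<bar>f y\<bar>) \<le> - U Y"
proof -
  have nn: "0 \<le> u y" if "y \<ge> Y" for y
    using le[OF that] by linarith
  have eq: "(\<integral>\<^sup>+y. ennreal (u y) * indicator {Y..} y \<partial>lborel) = ennreal (0 - U Y)"
    using u U nn by (intro nn_integral_FTC_atLeast) auto
  \<comment> \<open>\<open>ennreal\<close> sends negative reals to 0, so the sign is needed to read
    the real value back; U increases to its limit 0.\<close>
  have "U Y \<le> 0"
  proof (rule tendsto_lowerbound[OF U(2)])
    show "eventually (\<lambda>y. U Y \<le> U y) at_top"
      using eventually_ge_at_top[of Y]
    proof eventually_elim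
      case (elim y)
      show ?case
        by (rule DERIV_nonneg_imp_nondecreasing[OF elim]) (use U nn in blast)
    qed
  qed simp
  have bi: "has_bochner_integral lborel (\<lambda>y. indicator {Y..} y * u y) (- U Y)"
  proof (rule has_bochner_integral_nn_integral)
    have "(\<integral>\<^sup>+y. ennreal (indicator {Y..} y * u y) \<partial>lborel) = (\<integral>\<^sup>+y. ennreal (u y) * indicator {Y..} y \<partial>lborel)"
      by (intro nn_integral_cong) (auto simp: indicator_def)
    with eq show "(\<integral>\<^sup>+y. ennreal (indicator {Y..} y * u y) \<partial>lborel) = ennreal (- U Y)"
      by simp
  qed (use u nn \<open>U Y \<le> 0\<close> in \<open>auto simp: indicator_def\<close>)
  note int_u = has_bochner_integral_iff[THEN iffD1, OF bi]
  show "set_integrable lborel {Y..} f"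
    unfolding set_integrable_def
    by (rule Bochner_Integration.integrable_bound[OF conjunct1[OF int_u]]) (use f le nn in \<open>auto simp: indicator_def\<close>)
  have "(LINT y:{Y<..}|lborel. \<bar>f y\<bar>) \<le> (LINT y|lborel. indicator {Y..} y * u y)"
    unfolding set_lebesgue_integral_def
    by (rule integral_mono'[OF conjunct1[OF int_u]]) (use le nn in \<open>auto simp: indicator_def\<close>)
  then show "(LINT y:{Y<..}|lborel. \<bar>f y\<bar>) \<le> - U Y"
    using int_u by simp
qed

lemma borel_measurable_target_ft:
  assumes "\<tau> > 0" "\<beta> > 0"
  shows "target_ft \<tau> \<beta> \<in> borel_measurable borel"
  by (intro borel_measurable_continuous_onI continuous_at_imp_continuous_on ballI isCont_target_ft assms)

lemma target_ft_tail:
  assumes "\<tau> > 0" "\<beta> > 0" "Y > 0" and C: "\<And>y. y > 0 \<Longrightarrow> \<bar>target_ft \<tau> \<beta> y\<bar> \<le> C * \<tau> * y powr (- 1 - \<beta>)"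
  shows "set_integrable lborel {Y..} (target_ft \<tau> \<beta>)"
    "(LINT y:{Y<..}|lborel. \<bar>target_ft \<tau> \<beta> y\<bar>) \<le> C * \<tau> * Y powr (- \<beta>) / \<beta>"
proof -
  define U where "U y = - (C * \<tau> * y powr (- \<beta>) / \<beta>)" for y
  have dU: "(U has_real_derivative C * \<tau> * y powr (- 1 - \<beta>)) (at y)" if "y \<ge> Y" for y
    unfolding U_def using assms that by (auto intro!: derivative_eq_intros simp: minus_diff_commute)
  have "((\<lambda>y. y powr (- \<beta>)) \<longlongrightarrow> 0) at_top"
    using \<open>\<beta> > 0\<close> by (intro tendsto_neg_powr filterlim_ident) auto
  then have "(U \<longlongrightarrow> - (C * \<tau> * 0 / \<beta>)) at_top"
    unfolding U_def using \<open>\<beta> > 0\<close> by (intro tendsto_intros) auto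
  then have limU: "(U \<longlongrightarrow> 0) at_top"
    by simp
  note tail = set_integral_tail_le[OF borel_measurable_target_ft[OF assms(1,2)] _ dU limU]
  show "set_integrable lborel {Y..} (target_ft \<tau> \<beta>)"
    using assms by (intro tail(1)) auto
  show "(LINT y:{Y<..}|lborel. \<bar>target_ft \<tau> \<beta> y\<bar>) \<le> C * \<tau> * Y powr (- \<beta>) / \<beta>"
    using assms tail(2) by (simp add: U_def)
qed

text \<open>The decay bound is useless near 0, so it serves only for y >= 1; continuity covers the
  middle and symmetry the negative side.\<close>

lemma integrable_target_ft:
  assumes "\<tau> > 0" "\<beta> > 0"
  shows "integrable lborel (target_ft \<tau> \<beta>)"
proof -
  note [measurable] = borel_measurable_target_ft[OF assms]
  have cont: "continuous_on A (target_ft \<tau> \<beta>)" for A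
    by (intro continuous_at_imp_continuous_on ballI isCont_target_ft assms)
  obtain C where "\<And>y. y > 0 \<Longrightarrow> \<bar>target_ft \<tau> \<beta> y\<bar> \<le> C * \<tau> * y powr (- 1 - \<beta>)"
    using target_ft_decay[OF assms(2)] assms(1) by blast
  then have 1: "set_integrable lborel {1..} (target_ft \<tau> \<beta>)"
    by (intro target_ft_tail assms) auto
  have 2: "set_integrable lborel {-1..1} (target_ft \<tau> \<beta>)"
    unfolding set_integrable_def by (rule borel_integrable_compact) (use cont in auto)
  have 3: "set_integrable lborel {..-1} (target_ft \<tau> \<beta>)"
  proof -
    have "integrable lborel (\<lambda>y. indicat_real {1..} (0 + (-1) * y) *\<^sub>R target_ft \<tau> \<beta> (0 + (-1) * y))"
      using 1 unfolding set_integrable_def by (intro lborel_integrable_real_affine) auto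
    moreover have "indicat_real {1..} (- y) = indicat_real {..-1} y" for y :: real
      by (auto simp: indicator_def)
    ultimately show ?thesis
      by (simp add: set_integrable_def target_ft_minus[OF assms])
  qed
  have "set_integrable lborel (({..-1} \<union> {-1..1}) \<union> {1..}) (target_ft \<tau> \<beta>)"
    by (intro set_integrable_Un 1 2 3) auto
  moreover have "({..-1} \<union> {-1..1}) \<union> {1..} = (UNIV :: real set)"
    by auto
  ultimately show ?thesis
    by (simp add: set_integrable_def)
qed

lemma target_inversion:
  assumes "\<tau> > 0" "\<beta> > 0"
  shows "target \<tau> \<beta> x = (LINT y|lborel. target_ft \<tau> \<beta> y * cos (2 * pi * x * y))"
proof -
  have eq: "(\<lambda>y. LINT \<xi>|lborel. complex_of_real (target \<tau> \<beta> \<xi>) * cis (2 * pi * y * \<xi>)) = (\<lambda>y. complex_of_real (target_ft \<tau> \<beta> y))"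
    by (simp add: of_real_target_ft)
  have i: "integrable lborel (\<lambda>y. complex_of_real (target_ft \<tau> \<beta> y) * cis (- (2 * pi * x * y)))"
    by (intro integrable_cis_mult integrable_target_ft assms) simp
  have "(LINT y|lborel. complex_of_real (target_ft \<tau> \<beta> y) * cis (- (2 * pi * x * y))) = complex_of_real (target \<tau> \<beta> x)"
    using fourier_inversion[of "target \<tau> \<beta>" 1 x] assms unfolding eq
    by (auto simp: integrable_target isCont_target integrable_target_ft target_nonneg target_le_1
      simp flip: of_real_target_ft)
  then have "Re (LINT y|lborel. complex_of_real (target_ft \<tau> \<beta> y) * cis (- (2 * pi * x * y))) = target \<tau> \<beta> x"
    by simp
  then show ?thesis
    using i by (subst (asm) integral_Re[symmetric]) auto
qed

lemma target_truncated_inversion: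
  assumes "\<tau> > 0" "\<beta> > 0" "Y > 0"
  shows "\<bar>target \<tau> \<beta> x - 2 * integral {0..Y} (\<lambda>y. target_ft \<tau> \<beta> y * cos (2 * pi * x * y))\<bar>
    \<le> 2 * (LINT y:{Y<..}|lborel. \<bar>target_ft \<tau> \<beta> y\<bar>)"
proof -
  let ?F = "\<lambda>y. target_ft \<tau> \<beta> y * cos (2 * pi * x * y)"
  note [measurable] = borel_measurable_target_ft[OF assms(1,2)]
  have F: "integrable lborel ?F"
    by (rule Bochner_Integration.integrable_bound[OF integrable_target_ft[OF assms(1,2)]])
       (auto simp: abs_mult intro!: mult_left_le)
  have i: "set_integrable lborel A ?F" if "A \<in> sets lborel" for A
    unfolding set_integrable_def using that by (intro integrable_mult_indicator F)
  have "target \<tau> \<beta> x = 2 * (LINT y:{0..}|lborel. ?F y)"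
    unfolding target_inversion[OF assms(1,2), of x]
    by (intro lborel_integral_even F) (simp add: target_ft_minus[OF assms(1,2)])
  also have "{0..} = {0..Y} \<union> {Y<..}"
    using assms by auto
  also have "(LINT y:{0..Y} \<union> {Y<..}|lborel. ?F y) = (LINT y:{0..Y}|lborel. ?F y) + (LINT y:{Y<..}|lborel. ?F y)"
    by (intro set_integral_Un i) auto
  also have "(LINT y:{0..Y}|lborel. ?F y) = integral {0..Y} ?F"
    by (intro set_borel_integral_eq_integral i) auto
  finally have "\<bar>target \<tau> \<beta> x - 2 * integral {0..Y} ?F\<bar> = 2 * \<bar>LINT y:{Y<..}|lborel. ?F y\<bar>"
    by (simp add: distrib_left)
  also have "\<bar>LINT y:{Y<..}|lborel. ?F y\<bar> \<le> (LINT y|lborel. norm (indicator {Y<..} y *\<^sub>R ?F y))"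
    unfolding set_lebesgue_integral_def real_norm_def[symmetric] by (rule integral_norm_bound)
  also have "\<dots> \<le> (LINT y:{Y<..}|lborel. \<bar>target_ft \<tau> \<beta> y\<bar>)"
    unfolding set_lebesgue_integral_def
  proof (rule integral_mono')
    show "integrable lborel (\<lambda>y. indicat_real {Y<..} y *\<^sub>R \<bar>target_ft \<tau> \<beta> y\<bar>)"
      by (intro integrable_mult_indicator integrable_abs integrable_target_ft assms) auto
  qed (auto simp: indicator_def abs_mult intro!: mult_left_le)
  finally show ?thesis
    by simp
qed

text \<open>The error budget: 2 Y B for the Jacobi-Anger truncations, 2 E for the discarded
  frequencies, and a strict gap to \<eta> that a fine enough grid fits into.\<close>

lemma poisson_poly_approximates:
  assumes \<tau>: "\<tau> > 0" and \<beta>: "\<beta> > 0" and D: "D > 0" "even D" and Y: "Y > 0" "48 * Y \<le> real D"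
    and B: "\<And>y. 0 < y \<Longrightarrow> y \<le> Y \<Longrightarrow> \<bar>target_ft \<tau> \<beta> y\<bar> * (2 * (24 * y / real D) ^ D) \<le> B"
    and E: "(LINT y:{Y<..}|lborel. \<bar>target_ft \<tau> \<beta> y\<bar>) \<le> E"
    and \<eta>: "2 * Y * B + 2 * E < \<eta>"
  shows "\<exists>h>0. \<exists>N. approximates (poisson_poly \<tau> \<beta> h N D) (target \<tau> \<beta>) \<eta>"
proof -
  let ?f = "target_ft \<tau> \<beta>"
  \<comment> \<open>Three shares of the gap: the Riemann sum error enters twice, the term h f(0)
    once.\<close>
  define \<delta> where "\<delta> = (\<eta> - 2 * Y * B - 2 * E) / 3"
  have \<delta>: "\<delta> > 0"
    using \<eta> by (simp add: \<delta>_def)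
  have "continuous_on ({0..Y} \<times> {-1..1::real}) (\<lambda>p. ?f (fst p) * cos (2 * pi * snd p * fst p))"
    by (intro continuous_intros continuous_on_compose2[OF continuous_at_imp_continuous_on, of UNIV ?f])
       (auto intro: isCont_target_ft \<tau> \<beta>)
  then have "continuous_on ({0..Y} \<times> {-1..1::real}) (\<lambda>(y, x). ?f y * cos (2 * pi * x * y))"
    by (simp add: case_prod_unfold)
  from riemann_sum_uniform[OF Y(1) compact_Icc this \<delta>] obtain N0 where
    N0: "\<forall>N\<ge>N0. N > 0 \<longrightarrow> (\<forall>x\<in>{-1..1}.
      \<bar>(Y / real N) * (\<Sum>k=1..N. ?f (real k * (Y / real N)) * cos (2 * pi * x * (real k * (Y / real N))))
        - integral {0..Y} (\<lambda>y. ?f y * cos (2 * pi * x * y))\<bar> \<le> \<delta>)" ..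
  \<comment> \<open>The sum starts at k = 1, so the term h f(0) is a pure error; a small step makes
    it at most \<delta>.\<close>
  obtain N1 where N1: "real N1 > Y * \<bar>?f 0\<bar> / \<delta>"
    using reals_Archimedean2 by blast
  define N where "N = Suc (N0 + N1)"
  have N: "N \<ge> N0" "N \<ge> N1" "N > 0"
    by (auto simp: N_def)
  define h where "h = Y / real N"
  have h: "h > 0" "real N * h = Y"
    using Y N by (auto simp: h_def)
  have "Y * \<bar>?f 0\<bar> / \<delta> < real N"
    using N1 N by linarith
  then have f0: "\<bar>h * ?f 0\<bar> \<le> \<delta>"
    using \<delta> Y N by (simp add: h_def abs_mult field_simps)
  have "\<bar>poly (poisson_poly \<tau> \<beta> h N D) x - target \<tau> \<beta> x\<bar> \<le> \<eta>" if x: "x \<in> {-1..1}" for x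
  proof -
    define A where "A k = bessel_J 0 (2 * pi * real k * h) + 2 * (\<Sum>j=1..D div 2.
      (-1) ^ j * bessel_J (2 * j) (2 * pi * real k * h) * poly (chebyshev_T (2 * j)) x)" for k
    have P: "poly (poisson_poly \<tau> \<beta> h N D) x = h * ?f 0 + 2 * h * (\<Sum>k=1..N. ?f (real k * h) * A k)"
      by (simp add: poisson_poly_def poly_sum A_def)
    have summand: "\<bar>?f (real k * h) * A k - ?f (real k * h) * cos (2 * pi * x * (real k * h))\<bar> \<le> B" if k: "k \<in> {1..N}" for k
    proof -
      define y where "y = real k * h"
      have y: "0 < y" "y \<le> Y"
        using k h mult_right_mono[of "real k" "real N" h] by (auto simp: y_def)
      define z where "z = 2 * pi * real k * h"
      have z: "z = 2 * pi * y"
        by (simp add: z_def y_def)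
      \<comment> \<open>The origin of 24 and 48: with z = 2 pi y and pi <= 4, 3 z <= 24 y, and 6 z
        <= 48 y <= D.\<close>
      have pi: "pi * y \<le> 4 * y"
        using y pi_less_4 by (intro mult_right_mono) auto
      have "\<bar>A k - cos (z * x)\<bar> \<le> 2 * (3 * z / real D) ^ D"
        unfolding A_def z_def[symmetric]
      proof (rule jacobi_anger_truncation[OF D _ _ x])
        show "0 \<le> z"
          using y unfolding z by simp
        show "6 * z \<le> real D"
          using y Y pi unfolding z by linarith
      qed
      also have "\<dots> \<le> 2 * (24 * y / real D) ^ D"
      proof (intro mult_left_mono power_mono divide_right_mono)
        show "3 * z \<le> 24 * y"
          using pi unfolding z by linarith
      qed (use y z in auto)
      finally have "\<bar>?f y\<bar> * \<bar>A k - cos (z * x)\<bar> \<le> \<bar>?f y\<bar> * (2 * (24 * y / real D) ^ D)"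
        by (intro mult_left_mono) auto
      also have "\<dots> \<le> B"
        using y by (rule B)
      finally have "\<bar>?f y * (A k - cos (z * x))\<bar> \<le> B"
        by (simp only: abs_mult)
      moreover have "z * x = 2 * pi * x * y"
        by (simp add: z)
      ultimately show ?thesis
        by (simp only: y_def[symmetric] right_diff_distrib)
    qed
    have "\<bar>(\<Sum>k=1..N. ?f (real k * h) * A k) - (\<Sum>k=1..N. ?f (real k * h) * cos (2 * pi * x * (real k * h)))\<bar> \<le> real N * B"
      unfolding sum_subtractf[symmetric]
      using sum_mono[of "{1..N}" _ "\<lambda>_. B", OF summand] by (intro order.trans[OF sum_abs]) simp
    then have "2 * h * \<bar>(\<Sum>k=1..N. ?f (real k * h) * A k) - (\<Sum>k=1..N. ?f (real k * h) * cos (2 * pi * x * (real k * h)))\<bar>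
        \<le> 2 * h * (real N * B)"
      using h by (intro mult_left_mono) auto
    also have "\<dots> = 2 * (real N * h) * B"
      by (simp only: ac_simps)
    also have "\<dots> = 2 * Y * B"
      by (simp only: h(2))
    finally have 1: "\<bar>2 * h * (\<Sum>k=1..N. ?f (real k * h) * A k) - 2 * (h * (\<Sum>k=1..N. ?f (real k * h) * cos (2 * pi * x * (real k * h))))\<bar> \<le> 2 * Y * B"
      using h by (simp add: abs_mult mult.assoc flip: right_diff_distrib)
    have 2: "\<bar>h * (\<Sum>k=1..N. ?f (real k * h) * cos (2 * pi * x * (real k * h))) - integral {0..Y} (\<lambda>y. ?f y * cos (2 * pi * x * y))\<bar> \<le> \<delta>"
      unfolding h_def by (rule N0[rule_format, OF N(1,3) x])
    have 3: "\<bar>target \<tau> \<beta> x - 2 * integral {0..Y} (\<lambda>y. ?f y * cos (2 * pi * x * y))\<bar> \<le> 2 * E"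
      using target_truncated_inversion[OF \<tau> \<beta> Y(1), of x] E by linarith
    have "3 * \<delta> = \<eta> - 2 * Y * B - 2 * E"
      by (simp add: \<delta>_def)
    with 1 2 3 f0 show ?thesis
      unfolding P by linarith
  qed
  then show ?thesis
    using h(1) unfolding approximates_def by blast
qed

section \<open>Degree bounds\<close>

lemma target_bounds:
  assumes "\<tau> > 0" "\<beta> > 0" "x \<in> {-1..1}"
  shows "exp (- \<tau>) \<le> target \<tau> \<beta> x" "target \<tau> \<beta> x \<le> 1"
proof -
  have "\<bar>x\<bar> powr \<beta> \<le> 1 powr \<beta>"
    using assms by (intro powr_mono2) auto
  then have "\<tau> * \<bar>x\<bar> powr \<beta> \<le> \<tau>"
    using assms by simp
  then show "exp (- \<tau>) \<le> target \<tau> \<beta> x"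
    by (simp add: target_def)
  show "target \<tau> \<beta> x \<le> 1"
    using assms by (intro target_le_1)
qed

lemma target_ft_0_pos:
  assumes "\<tau> > 0" "\<beta> > 0"
  shows "target_ft \<tau> \<beta> 0 > 0"
proof -
  have "0 < (LINT x|lborel. indicat_real {-1..1::real} x * exp (- \<tau>))"
    by simp
  also have "\<dots> \<le> (LINT x|lborel. target \<tau> \<beta> x)"
    using target_bounds[OF assms] target_nonneg
    by (intro integral_mono' integrable_target assms) (auto simp: indicator_def)
  finally show ?thesis
    by (simp add: target_ft_eq_cos[OF assms])
qed

lemma poisson_poly_constant_approximates:
  assumes "\<tau> > 0" "\<beta> > 0" "\<tau> \<le> \<epsilon>"
  shows "\<exists>h>0. \<exists>N. approximates (poisson_poly \<tau> \<beta> h N D) (target \<tau> \<beta>) (\<epsilon> / 2)"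
proof -
  define h where "h = (1 + exp (- \<tau>)) / 2 / target_ft \<tau> \<beta> 0"
  have pos: "target_ft \<tau> \<beta> 0 > 0"
    by (intro target_ft_0_pos assms)
  then have h: "h > 0"
    by (simp add: h_def add_pos_pos)
  have "\<bar>poly (poisson_poly \<tau> \<beta> h 0 D) x - target \<tau> \<beta> x\<bar> \<le> \<epsilon> / 2" if "x \<in> {-1..1}" for x
  proof -
    have "poly (poisson_poly \<tau> \<beta> h 0 D) x = (1 + exp (- \<tau>)) / 2"
      using pos by (simp add: poisson_poly_def h_def)
    \<comment> \<open>Half the width of the range, (1 - exp (- \<tau>)) / 2, is therefore at most
      \<tau> / 2.\<close>
    moreover have "1 - \<tau> \<le> exp (- \<tau>)"
      using exp_ge_add_one_self[of "- \<tau>"] by simp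
    ultimately show ?thesis
      using target_bounds[OF assms(1,2) that] assms(3) unfolding abs_le_iff by argo
  qed
  then show ?thesis
    using h unfolding approximates_def by blast
qed

lemma nat_ceiling_bounds:
  fixes K X :: real
  assumes "K > 0" "X \<ge> 1"
  shows "1 \<le> nat \<lceil>K * X\<rceil>" "K * X \<le> real (nat \<lceil>K * X\<rceil>)" "real (nat \<lceil>K * X\<rceil>) \<le> (K + 1) * X"
proof -
  have "K * X > 0"
    using assms by simp
  then show "1 \<le> nat \<lceil>K * X\<rceil>" "K * X \<le> real (nat \<lceil>K * X\<rceil>)"
    by linarith+
  have "real (nat \<lceil>K * X\<rceil>) \<le> K * X + 1"
    using \<open>K * X > 0\<close> by linarith
  also have "\<dots> \<le> (K + 1) * X"
    using assms by (simp add: algebra_simps)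
  finally show "real (nat \<lceil>K * X\<rceil>) \<le> (K + 1) * X" .
qed

text \<open>For D >= 1 + \<beta> the truncation factor is at most (24 y / D)^(1+\<beta>), whose
  power of y cancels that of the decay bound. Multiplied by 2 Y = D / 24 this leaves \<tau>
  D^(-\<beta>), the same order as the tail beyond Y, so Y = D / 48 can be taken as large as the
  truncation permits.\<close>

lemma poisson_poly_degree_power_law:
  assumes \<beta>: "\<beta> > 0"
  shows "\<exists>C>0. \<forall>\<tau>>0. \<forall>\<epsilon>>0. \<exists>d\<ge>1. real d \<le> C * max 1 ((\<tau> / \<epsilon>) powr (1 / \<beta>)) \<and>
    (\<exists>h>0. \<exists>N. approximates (poisson_poly \<tau> \<beta> h N (2 * d)) (target \<tau> \<beta>) (\<epsilon> / 2))"
proof -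
  obtain C where C: "C > 0" "\<And>\<tau> y. \<tau> > 0 \<Longrightarrow> y > 0 \<Longrightarrow> \<bar>target_ft \<tau> \<beta> y\<bar> \<le> C * \<tau> * y powr (- 1 - \<beta>)"
    using target_ft_decay[OF \<beta>] by blast
  \<comment> \<open>2 C from the truncation plus 2 C / \<beta> from the tail, both multiplying
    \<tau> (48 / D)^\<beta>.\<close>
  define c where "c = 2 * C * (1 + 1 / \<beta>)"
  have c: "c > 0"
    using C \<beta> by (simp add: c_def add_pos_pos)
  \<comment> \<open>The first entry ensures D >= 1 + \<beta>; the second makes (48 / D)^\<beta> <=
    \<epsilon> / (4 c \<tau>), hence a total error of at most \<epsilon> / 4.\<close>
  define K where "K = max (1 + \<beta>) (48 * (4 * c) powr (1 / \<beta>))"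
  have K: "K > 0" "1 + \<beta> \<le> K" "48 * (4 * c) powr (1 / \<beta>) \<le> K"
    using \<beta> by (auto simp: K_def)
  have "\<exists>d\<ge>1. real d \<le> (K + 1) * max 1 ((\<tau> / \<epsilon>) powr (1 / \<beta>)) \<and>
    (\<exists>h>0. \<exists>N. approximates (poisson_poly \<tau> \<beta> h N (2 * d)) (target \<tau> \<beta>) (\<epsilon> / 2))"
    if \<tau>: "\<tau> > 0" and \<epsilon>: "\<epsilon> > 0" for \<tau> \<epsilon>
  proof (cases "\<tau> \<le> \<epsilon>")
    case True
    have "1 * 1 \<le> (K + 1) * max 1 ((\<tau> / \<epsilon>) powr (1 / \<beta>))"
      using K by (intro mult_mono) auto
    then show ?thesis
      using poisson_poly_constant_approximates[OF \<tau> \<beta> True, of 2] by (intro exI[of _ 1]) auto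
  next
    case False
    define X where "X = (\<tau> / \<epsilon>) powr (1 / \<beta>)"
    have X: "X \<ge> 1"
      unfolding X_def using False \<epsilon> \<beta> by (intro ge_one_powr_ge_zero) auto
    define d where "d = nat \<lceil>K * X\<rceil>"
    define D where "D = 2 * d"
    note d = nat_ceiling_bounds[OF K(1) X, folded d_def]
    have KX: "K * X \<le> real D"
      using d unfolding D_def by linarith
    have "K * 1 \<le> K * X"
      using X K by (intro mult_left_mono) auto
    then have "1 + \<beta> \<le> real D"
      using K KX by linarith
    then have D: "D > 0" "even D" "1 + \<beta> \<le> real D"
      using d by (auto simp: D_def)
    define Y where "Y = real D / 48"
    have Y: "Y > 0" "48 * Y \<le> real D"
      using D by (auto simp: Y_def)
    have "\<exists>h>0. \<exists>N. approximates (poisson_poly \<tau> \<beta> h N D) (target \<tau> \<beta>) (\<epsilon> / 2)"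
    proof (rule poisson_poly_approximates[OF \<tau> \<beta> D(1,2) Y])
      show "\<bar>target_ft \<tau> \<beta> y\<bar> * (2 * (24 * y / real D) ^ D) \<le> 2 * C * \<tau> * (24 / real D) powr (1 + \<beta>)"
        if y: "0 < y" "y \<le> Y" for y
      proof -
        have q: "0 < 24 * y / real D" "24 * y / real D \<le> 1"
          using y D by (auto simp: Y_def field_simps)
        have "(24 * y / real D) ^ D = (24 * y / real D) powr real D"
          using q by (simp add: powr_realpow)
        also have "\<dots> \<le> (24 * y / real D) powr (1 + \<beta>)"
          using q D by (intro powr_mono') auto
        also have "24 * y / real D = (24 / real D) * y"
          by simp
        also have "((24 / real D) * y) powr (1 + \<beta>) = (24 / real D) powr (1 + \<beta>) * y powr (1 + \<beta>)"
          by (rule powr_mult)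
        finally have "\<bar>target_ft \<tau> \<beta> y\<bar> * (2 * (24 * y / real D) ^ D)
           \<le> (C * \<tau> * y powr (- 1 - \<beta>)) * (2 * ((24 / real D) powr (1 + \<beta>) * y powr (1 + \<beta>)))"
          using C(2)[OF \<tau> y(1)] q by (intro mult_mono) auto
        also have "\<dots> = 2 * C * \<tau> * (24 / real D) powr (1 + \<beta>) * (y powr (- 1 - \<beta>) * y powr (1 + \<beta>))"
          by (simp only: ac_simps)
        also have "y powr (- 1 - \<beta>) * y powr (1 + \<beta>) = 1"
          using y by (simp flip: powr_add)
        finally show ?thesis
          by simp
      qed
      show "(LINT y:{Y<..}|lborel. \<bar>target_ft \<tau> \<beta> y\<bar>) \<le> C * \<tau> * Y powr (- \<beta>) / \<beta>"
        using target_ft_tail(2)[OF \<tau> \<beta> Y(1) C(2)[OF \<tau>]] .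
      have "2 * Y * (2 * C * \<tau> * (24 / real D) powr (1 + \<beta>)) = 2 * C * \<tau> * (24 / real D) powr \<beta>"
        using D by (simp add: Y_def powr_add)
      also have "\<dots> \<le> 2 * C * \<tau> * (48 / real D) powr \<beta>"
        using D C \<tau> \<beta> by (intro mult_left_mono powr_mono2 divide_right_mono) auto
      finally have "2 * Y * (2 * C * \<tau> * (24 / real D) powr (1 + \<beta>)) + 2 * (C * \<tau> * Y powr (- \<beta>) / \<beta>)
          \<le> 2 * C * \<tau> * (48 / real D) powr \<beta> + 2 * (C * \<tau> * (48 / real D) powr \<beta> / \<beta>)"
        using D by (simp add: Y_def powr_minus powr_divide field_simps)
      also have "\<dots> = c * \<tau> * (48 / real D) powr \<beta>"
        by (simp add: c_def algebra_simps)
      also have "\<dots> \<le> c * \<tau> * (\<epsilon> / \<tau> / (4 * c))"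
      proof (intro mult_left_mono)
        have "48 / real D \<le> 1 / ((4 * c) powr (1 / \<beta>) * X)"
        proof -
          have "48 * (4 * c) powr (1 / \<beta>) * X \<le> K * X"
            using K X by (intro mult_right_mono) auto
          then have "48 * ((4 * c) powr (1 / \<beta>) * X) \<le> real D"
            using KX by simp
          then show ?thesis
            using c X D by (simp add: field_simps)
        qed
        then have "(48 / real D) powr \<beta> \<le> (1 / ((4 * c) powr (1 / \<beta>) * X)) powr \<beta>"
          using \<beta> by (intro powr_mono2) auto
        also have "\<dots> = 1 / ((4 * c) * (\<tau> / \<epsilon>))"
          using c \<tau> \<epsilon> \<beta> by (simp add: X_def powr_divide powr_mult powr_powr)
        finally show "(48 / real D) powr \<beta> \<le> \<epsilon> / \<tau> / (4 * c)"
          by (simp add: field_simps)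
      qed (use c \<tau> in auto)
      also have "\<dots> = \<epsilon> / 4"
        using c \<tau> by simp
      also have "\<dots> < \<epsilon> / 2"
        using \<epsilon> by simp
      finally show "2 * Y * (2 * C * \<tau> * (24 / real D) powr (1 + \<beta>)) + 2 * (C * \<tau> * Y powr (- \<beta>) / \<beta>) < \<epsilon> / 2" .
    qed
    then show ?thesis
      using d X unfolding D_def X_def by (intro exI[of _ d]) (auto simp: max_def)
  qed
  then show ?thesis
    using K by (intro exI[of _ "K + 1"]) auto
qed

section \<open>Logarithmic degree for even exponents\<close>

lemma target_ft_tail_exp:
  assumes "\<tau> > 0" "\<beta> > 0" "Y > 0" "a > 0" and c: "\<And>y. y > 0 \<Longrightarrow> \<bar>target_ft \<tau> \<beta> y\<bar> \<le> c * exp (- a * y)"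
  shows "(LINT y:{Y<..}|lborel. \<bar>target_ft \<tau> \<beta> y\<bar>) \<le> c * exp (- a * Y) / a"
proof -
  define U where "U y = - (c * exp (- a * y) / a)" for y
  have dU: "(U has_real_derivative c * exp (- a * y)) (at y)" if "y \<ge> Y" for y
    unfolding U_def using assms by (auto intro!: derivative_eq_intros)
  have "((\<lambda>y. exp (- a * y)) \<longlongrightarrow> 0) at_top"
    using \<open>a > 0\<close> by real_asymp
  then have "(U \<longlongrightarrow> - (c * 0 / a)) at_top"
    unfolding U_def using \<open>a > 0\<close> by (intro tendsto_intros) auto
  then have limU: "(U \<longlongrightarrow> 0) at_top"
    by simp
  show ?thesis
    using set_integral_tail_le(2)[OF borel_measurable_target_ft[OF assms(1,2)] _ dU limU] assms
    by (simp add: U_def)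
qed

text \<open>With \<tau> s^n = L the shift costs only exp (C L), and the cutoff with Y s = a L gains
  exp (- 2 pi a L). Below the cutoff a bound uniform in y, times 2^(-D), is enough.\<close>

lemma poisson_poly_degree_even:
  assumes n: "even n" "n > 0"
  shows "\<exists>C>0. \<forall>\<tau>>0. \<forall>\<epsilon>. 0 < \<epsilon> \<and> \<epsilon> < 1/4 \<longrightarrow> (\<exists>d\<ge>1.
    real d \<le> C * max 1 ((\<tau> + ln (1 / \<epsilon>)) powr (1 / real n) * ln (1 / \<epsilon>) powr (1 - 1 / real n)) \<and>
    (\<exists>h>0. \<exists>N. approximates (poisson_poly \<tau> (real n) h N (2 * d)) (target \<tau> (real n)) (\<epsilon> / 2)))"
proof -
  obtain C K where C: "C > 0" and K: "K > 0" and decay: "\<forall>\<tau>>0. \<forall>y\<ge>0. \<forall>s\<ge>0.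
    \<bar>target_ft \<tau> (real n) y\<bar> \<le> K * \<tau> powr (- 1 / real n) * exp (C * \<tau> * s ^ n - 2 * pi * y * s)"
    using target_ft_decay_even[OF n] by (elim exE conjE)
  have n1: "1 / real n \<le> 1" "0 < 1 / real n" "0 < real n"
    using n by auto
  \<comment> \<open>C pays for the shift, 1 produces \<epsilon> = exp (- L), and 16 K brings the
    prefactor K below 1/16.\<close>
  define a where "a = C + 1 + 16 * K"
  \<comment> \<open>2^(-D) is at most exp (- b L / 2). The 4 yields two factors exp (- L), one
    against L powr (1 - 1/n) and one for \<epsilon>; the rest brings 4 a K below 1/16.\<close>
  define b where "b = 4 + 128 * a * K"
  have ab: "a > 0" "b > 0"
    using C K by (auto simp: a_def b_def add_pos_pos)
  define M where "M = 48 * a + b"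
  have M: "M > 0"
    using ab by (simp add: M_def)
  have "\<exists>d\<ge>1. real d \<le> (M + 1) * max 1 ((\<tau> + ln (1 / \<epsilon>)) powr (1 / real n) * ln (1 / \<epsilon>) powr (1 - 1 / real n)) \<and>
      (\<exists>h>0. \<exists>N. approximates (poisson_poly \<tau> (real n) h N (2 * d)) (target \<tau> (real n)) (\<epsilon> / 2))"
    if \<tau>: "\<tau> > 0" and \<epsilon>: "0 < \<epsilon>" "\<epsilon> < 1/4" for \<tau> \<epsilon>
  proof -
    define L where "L = ln (1 / \<epsilon>)"
    have expL: "exp (- L) = \<epsilon>"
      using \<epsilon> by (simp add: L_def ln_div)
    have L: "L \<ge> 1"
    proof -
      have "exp 1 \<le> (3 :: real)"
        by (rule exp_le)
      also have "3 \<le> 1 / \<epsilon>"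
        using \<epsilon> by (simp add: field_simps)
      finally show ?thesis
        using \<epsilon> by (simp add: L_def ln_ge_iff)
    qed
    define X where "X = (\<tau> + L) powr (1 / real n) * L powr (1 - 1 / real n)"
    have LL: "L powr (1 / real n) * L powr (1 - 1 / real n) = L"
      using L by (simp flip: powr_add)
    \<comment> \<open>Here the summand L beside \<tau> is used: L is itself the product of L^(1/n)
      and L^(1-1/n).\<close>
    have XL: "L \<le> X"
      unfolding X_def by (subst LL[symmetric]) (use \<tau> L n1 in \<open>intro mult_right_mono powr_mono2, auto\<close>)
    have X\<tau>: "\<tau> powr (1 / real n) * L powr (1 - 1 / real n) \<le> X"
      unfolding X_def using \<tau> L n1 by (intro mult_right_mono powr_mono2) auto
    have X: "X \<ge> 1"
      using XL L by simp
    define d where "d = nat \<lceil>M * X\<rceil>"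
    define D where "D = 2 * d"
    note d = nat_ceiling_bounds[OF M X, folded d_def]
    define Y where "Y = a * (\<tau> powr (1 / real n) * L powr (1 - 1 / real n))"
    define s where "s = (L / \<tau>) powr (1 / real n)"
    have s: "s > 0" "\<tau> * s ^ n = L" "Y * s = a * L" "\<tau> powr (- 1 / real n) \<le> s"
    proof -
      show s0: "s > 0"
        using L \<tau> by (simp add: s_def)
      have "s ^ n = s powr real n"
        using s0 by (rule powr_realpow[symmetric])
      also have "\<dots> = L / \<tau>"
        using L \<tau> n1 by (simp add: s_def powr_powr)
      finally show "\<tau> * s ^ n = L"
        using \<tau> by simp
      have "Y * s = a * (L powr (1 / real n) * L powr (1 - 1 / real n))"
        using \<tau> L by (simp add: Y_def s_def powr_divide)
      then show "Y * s = a * L"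
        by (simp only: LL)
      \<comment> \<open>As L >= 1, s is at least the scale \<tau>^(-1/n); this cancels the prefactor
        against the 1 / (2 pi s) from integrating the tail.\<close>
      have "\<tau> powr (- 1 / real n) = (1 / \<tau>) powr (1 / real n)"
        using \<tau> by (simp add: powr_divide powr_minus_divide flip: minus_divide_left)
      also have "\<dots> \<le> s"
        unfolding s_def using \<tau> L n1 by (intro powr_mono2 divide_right_mono) auto
      finally show "\<tau> powr (- 1 / real n) \<le> s" .
    qed
    have Y: "Y > 0"
      using ab \<tau> L by (simp add: Y_def)
    have DM: "M * X \<le> real D"
      using d unfolding D_def by linarith
    have D: "D > 0" "even D" "48 * Y \<le> real D" "b * L \<le> real D"
    proof -
      show "D > 0" "even D"
        using d by (auto simp: D_def)
      have "48 * Y \<le> 48 * a * X"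
        using X\<tau> ab unfolding Y_def by simp
      moreover have "b * L \<le> b * X"
        using XL ab by simp
      moreover have "0 \<le> 48 * a * X" "0 \<le> b * X"
        using X ab by auto
      moreover have "M * X = 48 * a * X + b * X"
        by (simp add: M_def distrib_right)
      ultimately show "48 * Y \<le> real D" "b * L \<le> real D"
        using DM by linarith+
    qed
    have half: "(1/2) ^ D \<le> exp (- (b * L / 2))"
    proof -
      have "exp (1/2 :: real) ^ 2 \<le> 2 ^ 2"
        using exp_le by (simp flip: exp_of_nat_mult)
      then have "exp (1/2 :: real) \<le> 2"
        by (rule power2_le_imp_le) simp
      then have "1/2 \<le> exp (- (1/2 :: real))"
        by (simp add: exp_minus field_simps)
      then have "(1/2) ^ D \<le> exp (- (1/2 :: real)) ^ D"
        by (intro power_mono) auto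
      also have "\<dots> = exp (real D * - (1/2))"
        by (rule exp_of_nat_mult[symmetric])
      also have "\<dots> \<le> exp (- (b * L / 2))"
        using D by simp
      finally show ?thesis .
    qed
    have "\<exists>h>0. \<exists>N. approximates (poisson_poly \<tau> (real n) h N D) (target \<tau> (real n)) (\<epsilon> / 2)"
    proof (rule poisson_poly_approximates[OF \<tau> n1(3) D(1,2) Y D(3)])
      show "\<bar>target_ft \<tau> (real n) y\<bar> * (2 * (24 * y / real D) ^ D) \<le> K * \<tau> powr (- 1 / real n) * (2 * (1/2) ^ D)"
        if y: "0 < y" "y \<le> Y" for y
      proof (intro mult_mono power_mono)
        \<comment> \<open>The decay bound at shift 0, where the exponential is 1 because 0^n =
          0.\<close>
        show "\<bar>target_ft \<tau> (real n) y\<bar> \<le> K * \<tau> powr (- 1 / real n)"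
          using decay[rule_format, OF \<tau>, of y 0] y n by (simp add: power_0_left)
        show "24 * y / real D \<le> 1/2"
          using y D by (simp add: field_simps)
      qed (use y K in auto)
      have tail: "(LINT y:{Y<..}|lborel. \<bar>target_ft \<tau> (real n) y\<bar>)
          \<le> (K * \<tau> powr (- 1 / real n) * exp (C * L)) * exp (- (2 * pi * s) * Y) / (2 * pi * s)"
      proof (rule target_ft_tail_exp[OF \<tau> n1(3) Y])
        fix y :: real assume y: "y > 0"
        have "\<bar>target_ft \<tau> (real n) y\<bar> \<le> K * \<tau> powr (- 1 / real n) * exp (C * \<tau> * s ^ n - 2 * pi * y * s)"
          using decay[rule_format, OF \<tau>, of y s] y s by simp
        also have "C * \<tau> * s ^ n - 2 * pi * y * s = C * L + - (2 * pi * s) * y"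
          by (simp add: mult.assoc s(2))
        finally show "\<bar>target_ft \<tau> (real n) y\<bar> \<le> K * \<tau> powr (- 1 / real n) * exp (C * L) * exp (- (2 * pi * s) * y)"
          by (simp only: exp_add mult.assoc)
      qed (use s in simp)
      have "(K * \<tau> powr (- 1 / real n) * exp (C * L)) * exp (- (2 * pi * s) * Y) / (2 * pi * s)
          = K * (\<tau> powr (- 1 / real n) / (2 * pi * s)) * exp (C * L - 2 * pi * (Y * s))"
        by (simp add: exp_diff exp_minus field_simps)
      also have "\<dots> \<le> K * 1 * exp (C * L - a * L)"
      proof (intro mult_mono)
        have "1 * s \<le> 2 * pi * s"
          using s pi_ge_two by (intro mult_right_mono) auto
        then have "\<tau> powr (- 1 / real n) \<le> 2 * pi * s"
          using s by linarith
        then show "\<tau> powr (- 1 / real n) / (2 * pi * s) \<le> 1"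
          using s by simp
        have "1 * (a * L) \<le> 2 * pi * (a * L)"
          using ab L pi_ge_two by (intro mult_right_mono) auto
        then show "exp (C * L - 2 * pi * (Y * s)) \<le> exp (C * L - a * L)"
          by (simp add: s(3))
      qed (use K s in auto)
      also have "\<dots> = K * exp (- (16 * K) * L) * \<epsilon>"
        by (simp add: a_def algebra_simps exp_diff flip: expL exp_add)
      also have "\<dots> \<le> 1 / 16 * \<epsilon>"
      proof (intro mult_right_mono)
        have "16 * K * 1 \<le> 16 * K * L"
          using K L by (intro mult_left_mono) auto
        then have "16 * K \<le> exp (16 * K * L)"
          using exp_ge_add_one_self[of "16 * K * L"] by linarith
        then show "K * exp (- (16 * K) * L) \<le> 1 / 16"
          by (simp add: exp_minus field_simps)
      qed (use \<epsilon> in auto)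
      finally show "(LINT y:{Y<..}|lborel. \<bar>target_ft \<tau> (real n) y\<bar>) \<le> 1 / 16 * \<epsilon>"
        using tail by linarith
      have "2 * Y * (K * \<tau> powr (- 1 / real n) * (2 * (1/2) ^ D))
          = 4 * a * K * L powr (1 - 1 / real n) * (\<tau> powr (1 / real n) * \<tau> powr (- 1 / real n)) * (1/2) ^ D"
        by (simp add: Y_def)
      also have "\<tau> powr (1 / real n) * \<tau> powr (- 1 / real n) = 1"
        using \<tau> by (simp flip: powr_add)
      also have "4 * a * K * L powr (1 - 1 / real n) * 1 * (1/2) ^ D \<le> 4 * a * K * exp L * 1 * exp (- (b * L / 2))"
      proof (intro mult_mono half)
        have "L powr (1 - 1 / real n) \<le> L powr 1"
          using L n1 by (intro powr_mono) auto
        also have "\<dots> \<le> 1 + L"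
          using L by simp
        also have "\<dots> \<le> exp L"
          by (rule exp_ge_add_one_self)
        finally show "L powr (1 - 1 / real n) \<le> exp L" .
      qed (use ab K in auto)
      also have "\<dots> = 4 * a * K * exp (- (64 * a * K) * L) * \<epsilon>"
        by (simp add: b_def algebra_simps flip: expL exp_add)
      also have "\<dots> \<le> 1 / 16 * \<epsilon>"
      proof (intro mult_right_mono)
        have "64 * a * K * 1 \<le> 64 * a * K * L"
          using K L ab by (intro mult_left_mono) auto
        then have "64 * a * K \<le> exp (64 * a * K * L)"
          using exp_ge_add_one_self[of "64 * a * K * L"] by linarith
        then show "4 * a * K * exp (- (64 * a * K) * L) \<le> 1 / 16"
          by (simp add: exp_minus field_simps)
      qed (use \<epsilon> in auto)
      finally show "2 * Y * (K * \<tau> powr (- 1 / real n) * (2 * (1/2) ^ D)) + 2 * (1 / 16 * \<epsilon>) < \<epsilon> / 2"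
        using \<epsilon> by linarith
    qed
    then show ?thesis
      using d X unfolding D_def X_def L_def by (intro exI[of _ d]) (auto simp: max_def)
  qed
  then show ?thesis
    using M by (intro exI[of _ "M + 1"]) auto
qed

section \<open>The trivial regime, scaling in the norm, and assembly\<close>

lemma approximates_one:
  assumes "\<tau> > 0" "\<beta> > 0" "\<tau> \<le> \<epsilon>"
  shows "approximates 1 (target \<tau> \<beta>) \<epsilon>"
  unfolding approximates_def
proof
  fix x :: real assume "x \<in> {-1..1}"
  note b = target_bounds[OF assms(1,2) this]
  have "1 - \<tau> \<le> exp (- \<tau>)"
    using exp_ge_add_one_self[of "- \<tau>"] by simp
  then show "\<bar>poly 1 x - target \<tau> \<beta> x\<bar> \<le> \<epsilon>"
    using b assms(3) unfolding poly_1 abs_le_iff by argo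
qed

lemma approximates_one_S_target:
  assumes "\<tau> > 0" "\<alpha> > 0" "\<tau> \<le> \<epsilon>"
  shows "approximates 1 (S_target \<tau> \<alpha>) \<epsilon>"
  unfolding approximates_def
proof
  fix s :: real assume s: "s \<in> {-1..1}"
  then have "sqrt ((1 + s) / 2) \<in> {-1..1}"
    by (auto simp: real_le_lsqrt real_sqrt_ge_zero order.trans[of "-1" "0::real"])
  then show "\<bar>poly 1 s - S_target \<tau> \<alpha> s\<bar> \<le> \<epsilon>"
    using approximates_one[of \<tau> "2 * \<alpha>" \<epsilon>] assms unfolding approximates_def S_target_eq_target[OF s]
    by simp
qed

text \<open>Used with m = 2 for \<open>U_H\<close>, where the degree is 2d, and with m = 1 for
  \<open>U_S\<close>, where it is d.\<close>

lemma degree_bound_mult: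
  assumes "1 \<le> d" "real d \<le> C * max 1 X" "m > 0" "real m * C \<le> C'"
  shows "degree_bound C' (m * d) X"
proof -
  have "real m * real d \<le> real m * (C * max 1 X)"
    using assms by (intro mult_left_mono) auto
  also have "\<dots> \<le> C' * max 1 X"
    using assms(4) by (simp only: mult.assoc[symmetric]) (intro mult_right_mono, auto)
  finally show ?thesis
    using assms by (simp add: degree_bound_def)
qed

text \<open>With \<beta> = \<alpha> the norm factors out linearly, with \<beta> = 2 \<alpha> as a
  square root.\<close>

lemma scale_power_law:
  fixes t r \<epsilon> \<alpha> \<beta> :: real
  shows "(t * r powr \<alpha> / \<epsilon>) powr (1 / \<beta>) = r powr (\<alpha> / \<beta>) * (t / \<epsilon>) powr (1 / \<beta>)"
proof -
  have *: "t * r powr \<alpha> / \<epsilon> = r powr \<alpha> * (t / \<epsilon>)"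
    by simp
  have "\<alpha> / \<beta> = \<alpha> * (1 / \<beta>)"
    by simp
  then show ?thesis
    unfolding * powr_mult powr_powr by (simp only:)
qed

theorem mainTheorem3:
  fixes \<alpha> :: real
  assumes "\<alpha> > 0"
  shows "\<exists>C > 0. \<forall>(n :: nat) (H :: complex mat) (T :: real) (\<epsilon> :: real).
    H \<in> carrier_mat n n \<and> H \<noteq> 0\<^sub>m n n \<and> hermitian_psd H \<and> T > 0 \<and> 0 < \<epsilon> \<and> \<epsilon> < 1/4 \<longrightarrow>
    (let \<tau> = T * op_norm H powr \<alpha>; L = ln (1/\<epsilon>) in
      (\<forall>a U\<^sub>H. block_encoding a U\<^sub>H (complex_of_real (1 / op_norm H) \<cdot>\<^sub>m H) \<longrightarrow>
        ((\<exists>k :: nat. k > 0 \<and> even k \<and> \<alpha> = real k) \<longrightarrow>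
          (\<exists>d. degree_bound C d ((\<tau> + L) powr (1/\<alpha>) * L powr (1 - 1/\<alpha>)) \<and>
               H_compiled \<tau> \<alpha> (\<epsilon>/2) d)) \<and>
        ((\<exists>k :: nat. odd k \<and> \<alpha> = real k) \<or> \<alpha> \<notin> \<int> \<longrightarrow>
          (\<exists>d. degree_bound C d (op_norm H * (T/\<epsilon>) powr (1/\<alpha>)) \<and>
               H_compiled \<tau> \<alpha> (\<epsilon>/2) d)) \<and>
        (\<tau> \<le> \<epsilon> \<longrightarrow>
          approximates 1 (target \<tau> \<alpha>) \<epsilon> \<and>
          (\<exists>d. degree_bound C d 0 \<and> H_compiled \<tau> \<alpha> (\<epsilon>/2) d))) \<and>
      (\<forall>a U\<^sub>S. block_encoding a U\<^sub>S (complex_of_real (2 / op_norm H) \<cdot>\<^sub>m H - 1\<^sub>m n) \<longrightarrow>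
        ((\<exists>k :: nat. k > 0 \<and> \<alpha> = real k) \<longrightarrow>
          (\<exists>d. degree_bound C d ((\<tau> + L) powr (1/(2*\<alpha>)) * L powr (1 - 1/(2*\<alpha>))) \<and>
               S_compiled \<tau> \<alpha> (\<epsilon>/2) d)) \<and>
        (\<alpha> \<notin> \<int> \<longrightarrow>
          (\<exists>d. degree_bound C d (sqrt (op_norm H) * (T/\<epsilon>) powr (1/(2*\<alpha>))) \<and>
               S_compiled \<tau> \<alpha> (\<epsilon>/2) d)) \<and>
        (\<tau> \<le> \<epsilon> \<longrightarrow>
          approximates 1 (S_target \<tau> \<alpha>) \<epsilon> \<and>
          (\<exists>d. degree_bound C d 0 \<and> S_compiled \<tau> \<alpha> (\<epsilon>/2) d))))"
proof -
  let ?P = "\<lambda>\<tau> \<beta> \<epsilon> d. \<exists>h>0. \<exists>N. approximates (poisson_poly \<tau> \<beta> h N (2 * d)) (target \<tau> \<beta>) (\<epsilon> / 2)"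
  have power_law: "\<exists>C>0. \<forall>\<tau>>0. \<forall>\<epsilon>>0. \<exists>d\<ge>1. real d \<le> C * max 1 ((\<tau> / \<epsilon>) powr (1 / \<beta>)) \<and> ?P \<tau> \<beta> \<epsilon> d"
    if "\<beta> > 0" for \<beta>
    using poisson_poly_degree_power_law[OF that] .
  \<comment> \<open>The parity condition sits inside the existential so that a constant is available
    for every \<alpha>; outside the even integers any positive value will do.\<close>
  have even: "\<exists>C>0. (\<exists>k::nat. k > 0 \<and> even k \<and> \<beta> = real k) \<longrightarrow> (\<forall>\<tau>>0. \<forall>\<epsilon>. 0 < \<epsilon> \<and> \<epsilon> < 1/4 \<longrightarrow> (\<exists>d\<ge>1.
    real d \<le> C * max 1 ((\<tau> + ln (1 / \<epsilon>)) powr (1 / \<beta>) * ln (1 / \<epsilon>) powr (1 - 1 / \<beta>)) \<and> ?P \<tau> \<beta> \<epsilon> d))" for \<beta>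
  proof (cases "\<exists>k::nat. k > 0 \<and> even k \<and> \<beta> = real k")
    case True
    then obtain k :: nat where k: "even k" "k > 0" "\<beta> = real k"
      by blast
    show ?thesis
      using poisson_poly_degree_even[OF k(1,2)] unfolding k(3) by (elim exE conjE, intro exI conjI impI)
  next
    case False
    then show ?thesis
      by (intro exI[of _ 1]) auto
  qed
  have \<alpha>2: "2 * \<alpha> > 0"
    using assms by simp
  obtain C1 where C1: "C1 > 0" "\<forall>\<tau>>0. \<forall>\<epsilon>>0. \<exists>d\<ge>1. real d \<le> C1 * max 1 ((\<tau> / \<epsilon>) powr (1 / \<alpha>)) \<and> ?P \<tau> \<alpha> \<epsilon> d"
    using power_law[OF assms] by (elim exE conjE)
  obtain C2 where C2: "C2 > 0" "\<forall>\<tau>>0. \<forall>\<epsilon>>0. \<exists>d\<ge>1. real d \<le> C2 * max 1 ((\<tau> / \<epsilon>) powr (1 / (2 * \<alpha>))) \<and> ?P \<tau> (2 * \<alpha>) \<epsilon> d"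
    using power_law[OF \<alpha>2] by (elim exE conjE)
  obtain C3 where C3: "C3 > 0" "(\<exists>k::nat. k > 0 \<and> even k \<and> \<alpha> = real k) \<longrightarrow> (\<forall>\<tau>>0. \<forall>\<epsilon>. 0 < \<epsilon> \<and> \<epsilon> < 1/4 \<longrightarrow> (\<exists>d\<ge>1.
    real d \<le> C3 * max 1 ((\<tau> + ln (1 / \<epsilon>)) powr (1 / \<alpha>) * ln (1 / \<epsilon>) powr (1 - 1 / \<alpha>)) \<and> ?P \<tau> \<alpha> \<epsilon> d))"
    using even[of \<alpha>] by (elim exE conjE)
  obtain C4 where C4: "C4 > 0" "(\<exists>k::nat. k > 0 \<and> even k \<and> 2 * \<alpha> = real k) \<longrightarrow> (\<forall>\<tau>>0. \<forall>\<epsilon>. 0 < \<epsilon> \<and> \<epsilon> < 1/4 \<longrightarrow> (\<exists>d\<ge>1.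
    real d \<le> C4 * max 1 ((\<tau> + ln (1 / \<epsilon>)) powr (1 / (2 * \<alpha>)) * ln (1 / \<epsilon>) powr (1 - 1 / (2 * \<alpha>))) \<and> ?P \<tau> (2 * \<alpha>) \<epsilon> d))"
    using even[of "2 * \<alpha>"] by (elim exE conjE)
  \<comment> \<open>The factor 2 covers degree 2d in the \<open>U_H\<close> case, and the summand 1
    ensures C >= 2, as needed for the degree 2 used when \<tau> <= \<epsilon>.\<close>
  define C where "C = 2 * (C1 + C2 + C3 + C4 + 1)"
  have C: "real 2 * C1 \<le> C" "real 1 * C2 \<le> C" "real 2 * C3 \<le> C" "real 1 * C4 \<le> C" "2 \<le> C"
    using C1 C2 C3 C4 by (auto simp: C_def)
  show ?thesis
  proof (intro exI[of _ C] conjI allI impI, goal_cases)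
    case 1
    show ?case
      using C by simp
  next
    case (2 n H T \<epsilon>)
    then have r: "op_norm H > 0" and T: "T > 0" and \<epsilon>: "0 < \<epsilon>" "\<epsilon> < 1/4"
      using op_norm_pos by auto
    define \<tau> where "\<tau> = T * op_norm H powr \<alpha>"
    have \<tau>: "\<tau> > 0"
      using T r by (simp add: \<tau>_def)
    have H_even: "\<exists>d. degree_bound C d ((\<tau> + ln (1 / \<epsilon>)) powr (1 / \<alpha>) * ln (1 / \<epsilon>) powr (1 - 1 / \<alpha>)) \<and>
        H_compiled \<tau> \<alpha> (\<epsilon> / 2) d" if k: "\<exists>k::nat. k > 0 \<and> even k \<and> \<alpha> = real k"
    proof -
      obtain d h N where d: "1 \<le> d" "real d \<le> C3 * max 1 ((\<tau> + ln (1 / \<epsilon>)) powr (1 / \<alpha>) * ln (1 / \<epsilon>) powr (1 - 1 / \<alpha>))"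
        and h: "h > 0" "approximates (poisson_poly \<tau> \<alpha> h N (2 * d)) (target \<tau> \<alpha>) (\<epsilon> / 2)"
        using C3(2)[THEN mp, OF k, rule_format, OF \<tau> conjI[OF \<epsilon>]] by (elim exE conjE)
      show ?thesis
        by (intro exI[of _ "2 * d"] conjI degree_bound_mult[OF d _ C(3)] H_compiledI[OF _ h]) simp_all
    qed
    have H_law: "\<exists>d. degree_bound C d (op_norm H * (T / \<epsilon>) powr (1 / \<alpha>)) \<and> H_compiled \<tau> \<alpha> (\<epsilon> / 2) d"
    proof -
      obtain d h N where d: "1 \<le> d" "real d \<le> C1 * max 1 ((\<tau> / \<epsilon>) powr (1 / \<alpha>))"
        and h: "h > 0" "approximates (poisson_poly \<tau> \<alpha> h N (2 * d)) (target \<tau> \<alpha>) (\<epsilon> / 2)"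
        using C1(2)[rule_format, OF \<tau> \<epsilon>(1)] by (elim exE conjE)
      have "(\<tau> / \<epsilon>) powr (1 / \<alpha>) = op_norm H * (T / \<epsilon>) powr (1 / \<alpha>)"
        using scale_power_law[of T "op_norm H" \<alpha> \<epsilon> \<alpha>] assms r by (simp add: \<tau>_def)
      then show ?thesis
        using degree_bound_mult[OF d _ C(1)] H_compiledI[OF _ h] by (intro exI[of _ "2 * d"]) simp
    qed
    have H_small: "\<exists>d. degree_bound C d 0 \<and> H_compiled \<tau> \<alpha> (\<epsilon> / 2) d" if small: "\<tau> \<le> \<epsilon>"
    proof -
      obtain h N where h: "h > 0" "approximates (poisson_poly \<tau> \<alpha> h N 2) (target \<tau> \<alpha>) (\<epsilon> / 2)"
        using poisson_poly_constant_approximates[OF \<tau> assms small, of 2] by (elim exE conjE)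
      show ?thesis
        using H_compiledI[OF _ h] C by (intro exI[of _ 2]) (simp add: degree_bound_def)
    qed
    have S_even: "\<exists>d. degree_bound C d ((\<tau> + ln (1 / \<epsilon>)) powr (1 / (2 * \<alpha>)) * ln (1 / \<epsilon>) powr (1 - 1 / (2 * \<alpha>))) \<and>
        S_compiled \<tau> \<alpha> (\<epsilon> / 2) d" if k: "\<exists>k::nat. k > 0 \<and> \<alpha> = real k"
    proof -
      \<comment> \<open>Doubling turns odd \<alpha> into an even exponent too, so the logarithmic
        bound covers all positive integers here.\<close>
      have *: "\<exists>k::nat. k > 0 \<and> even k \<and> 2 * \<alpha> = real k"
      proof -
        obtain m :: nat where "m > 0" "\<alpha> = real m"
          using k by (elim exE conjE)
        then show ?thesis
          by (intro exI[of _ "2 * m"]) simp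
      qed
      obtain d h N where d: "1 \<le> d" "real d \<le> C4 * max 1 ((\<tau> + ln (1 / \<epsilon>)) powr (1 / (2 * \<alpha>)) * ln (1 / \<epsilon>) powr (1 - 1 / (2 * \<alpha>)))"
        and h: "h > 0" "approximates (poisson_poly \<tau> (2 * \<alpha>) h N (2 * d)) (target \<tau> (2 * \<alpha>)) (\<epsilon> / 2)"
        using C4(2)[THEN mp, OF *, rule_format, OF \<tau> conjI[OF \<epsilon>]] by (elim exE conjE)
      show ?thesis
        by (intro exI[of _ d] conjI degree_bound_mult[OF d _ C(4), simplified] S_compiledI[OF h])
    qed
    have S_law: "\<exists>d. degree_bound C d (sqrt (op_norm H) * (T / \<epsilon>) powr (1 / (2 * \<alpha>))) \<and> S_compiled \<tau> \<alpha> (\<epsilon> / 2) d"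
    proof -
      obtain d h N where d: "1 \<le> d" "real d \<le> C2 * max 1 ((\<tau> / \<epsilon>) powr (1 / (2 * \<alpha>)))"
        and h: "h > 0" "approximates (poisson_poly \<tau> (2 * \<alpha>) h N (2 * d)) (target \<tau> (2 * \<alpha>)) (\<epsilon> / 2)"
        using C2(2)[rule_format, OF \<tau> \<epsilon>(1)] by (elim exE conjE)
      have "\<alpha> / (2 * \<alpha>) = 1 / 2"
        using assms by simp
      then have "(\<tau> / \<epsilon>) powr (1 / (2 * \<alpha>)) = sqrt (op_norm H) * (T / \<epsilon>) powr (1 / (2 * \<alpha>))"
        using scale_power_law[of T "op_norm H" \<alpha> \<epsilon> "2 * \<alpha>"] assms r by (simp add: \<tau>_def powr_half_sqrt)
      then show ?thesis
        using degree_bound_mult[OF d _ C(2)] S_compiledI[OF h] by (intro exI[of _ d]) simp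
    qed
    have S_small: "\<exists>d. degree_bound C d 0 \<and> S_compiled \<tau> \<alpha> (\<epsilon> / 2) d" if small: "\<tau> \<le> \<epsilon>"
    proof -
      obtain h N where h: "h > 0" "approximates (poisson_poly \<tau> (2 * \<alpha>) h N (2 * 1)) (target \<tau> (2 * \<alpha>)) (\<epsilon> / 2)"
        using poisson_poly_constant_approximates[OF \<tau> \<alpha>2 small, of "2 * 1"] by (elim exE conjE)
      show ?thesis
        using S_compiledI[OF h] C by (intro exI[of _ 1]) (simp add: degree_bound_def)
    qed
    show ?case
      unfolding Let_def \<tau>_def[symmetric]
      by (intro conjI allI impI H_even H_law H_small S_even S_law S_small
        approximates_one[OF \<tau> assms] approximates_one_S_target[OF \<tau> assms])
  qed
qed

end
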